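(* Let $n\ge 1$ and let $f=(f_1,\dots,f_n):\mathbb{R}^2\to\mathbb{R}^n$ be a $C^2$ map whose graph $\Sigma$, parametrized by $$\mathbf{\Phi}(x,y)=\big(F_1(x,y),F_2(x,y),F_3(x,y),\dots,F_{n+2}(x,y)\big)=\big(x,\,y,\,f_1(x,y),\dots,f_n(x,y)\big),\qquad (x,y)\in\mathbb{R}^2,$$ is a minimal surface in $\mathbb{R}^{n+2}$. Suppose that $(i,j)$ is a pair of indices with $1\le i<j\le n+2$ such that the Jacobian $$\mathcal{J}_{i,j}:=\frac{\partial(F_i,F_j)}{\partial(x,y)}=\frac{\partial F_i}{\partial x}\frac{\partial F_j}{\partial y}-\frac{\partial F_i}{\partial y}\frac{\partial F_j}{\partial x}$$ is positive on all of $\mathbb{R}^2$ or negative on all of $\mathbb{R}^2$. Then the following two statements hold. (a) The image $\mathcal{G}(\Sigma)$ of $\Sigma$ under the Gauss map lies on a hyperplane of the form $z_i=\lambda_{(i,j)}\,z_j$ for some constant $\lambda_{(i,j)}\in\mathbb{C}\setminus\mathbb{R}$. (b) With this constant $\lambda_{(i,j)}$, there is a constant $\lambda\in\mathbb{C}\setminus\mathbb{R}$ such that on $\mathbb{R}^2$ $$\frac{\partial F_i}{\partial x}+\lambda\frac{\partial F_i}{\partial y}=\lambda_{(i,j)}\left(\frac{\partial F_j}{\partial x}+\lambda\frac{\partial F_j}{\partial y}\right).$$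
   Context: $\mathbb{R}^{n+2}$ carries the Euclidean metric $dx_1^2+\cdots+dx_{n+2}^2$. The graph of $f=(f_1,\dots,f_n)$ is a minimal surface (zero mean curvature), equivalently $f$ satisfies $G\,\partial_{xx}f_k-2F\,\partial_{xy}f_k+E\,\partial_{yy}f_k=0$ for $k=1,\dots,n$, where $E=1+\sum_k(\partial_x f_k)^2$, $F=\sum_k \partial_x f_k\,\partial_y f_k$, $G=1+\sum_k(\partial_y f_k)^2$. Generalized Gauss map: for a minimal surface $\Sigma$ in $\mathbb{R}^{n+2}$ (a graph being oriented by $(x,y)$) given by a conformal harmonic immersion $X$ with local conformal parameter $\xi=\xi_1+\sqrt{-1}\,\xi_2$ compatible with the orientation, $\mathcal{G}:\Sigma\to\mathcal{Q}_n\subset\mathbb{CP}^{n+1}$ is $$\mathcal{G}(\xi)=\left[\,\overline{\frac{\partial X}{\partial \xi}}\,\right]=\left[\frac{\partial X}{\partial\xi_1}+\sqrt{-1}\,\frac{\partial X}{\partial\xi_2}\right],$$ which does not depend on the choice of $\xi$. Here $[z_1:\cdots:z_{n+2}]$ are homogeneous coordinates on $\mathbb{CP}^{n+1}$ and $\mathcal{Q}_n=\{[z]: z_1^2+\cdots+z_{n+2}^2=0\}$. *)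

theory Defs
  imports "HOL-Analysis.Analysis"
begin

definition pd1 :: "(real \<times> real \<Rightarrow> real) \<Rightarrow> real \<times> real \<Rightarrow> real" where
  "pd1 g p = deriv (\<lambda>t. g (t, snd p)) (fst p)"

definition pd2 :: "(real \<times> real \<Rightarrow> real) \<Rightarrow> real \<times> real \<Rightarrow> real" where
  "pd2 g p = deriv (\<lambda>t. g (fst p, t)) (snd p)"

definition C1_on :: "(real \<times> real) set \<Rightarrow> (real \<times> real \<Rightarrow> real) \<Rightarrow> bool" where
  "C1_on U g \<longleftrightarrow>
     (\<forall>p\<in>U. (\<lambda>t. g (t, snd p)) field_differentiable at (fst p) \<and>
            (\<lambda>t. g (fst p, t)) field_differentiable at (snd p)) \<and>
     continuous_on U (pd1 g) \<and> continuous_on U (pd2 g)"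

definition C2_on :: "(real \<times> real) set \<Rightarrow> (real \<times> real \<Rightarrow> real) \<Rightarrow> bool" where
  "C2_on U g \<longleftrightarrow> C1_on U g \<and> C1_on U (pd1 g) \<and> C1_on U (pd2 g)"

definition harmonic_on :: "(real \<times> real) set \<Rightarrow> (real \<times> real \<Rightarrow> real) \<Rightarrow> bool" where
  "harmonic_on U g \<longleftrightarrow> C2_on U g \<and> (\<forall>p\<in>U. pd1 (pd1 g) p + pd2 (pd2 g) p = 0)"

definition jacobian_det ::
  "(real \<times> real \<Rightarrow> real) \<Rightarrow> (real \<times> real \<Rightarrow> real) \<Rightarrow> real \<times> real \<Rightarrow> real" where
  "jacobian_det g h p = pd1 g p * pd2 h p - pd2 g p * pd1 h p"


text \<open>
  A point of \<open>m\<close>-dimensional (real or complex) coordinate space is a function on \<open>nat\<close> that is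
  supported on the index set \<open>{1..m}\<close>. A parametrized surface is \<open>X :: real \<times> real \<Rightarrow> nat \<Rightarrow> real\<close>,
  with coordinate functions \<open>\<lambda>p. X p k\<close>.
\<close>

definition ffE :: "nat \<Rightarrow> (real \<times> real \<Rightarrow> nat \<Rightarrow> real) \<Rightarrow> real \<times> real \<Rightarrow> real" where
  "ffE m X p = (\<Sum>k=1..m. (pd1 (\<lambda>q. X q k) p)\<^sup>2)"

definition ffF :: "nat \<Rightarrow> (real \<times> real \<Rightarrow> nat \<Rightarrow> real) \<Rightarrow> real \<times> real \<Rightarrow> real" where
  "ffF m X p = (\<Sum>k=1..m. pd1 (\<lambda>q. X q k) p * pd2 (\<lambda>q. X q k) p)"

definition ffG :: "nat \<Rightarrow> (real \<times> real \<Rightarrow> nat \<Rightarrow> real) \<Rightarrow> real \<times> real \<Rightarrow> real" where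
  "ffG m X p = (\<Sum>k=1..m. (pd2 (\<lambda>q. X q k) p)\<^sup>2)"

definition normal_vector ::
  "nat \<Rightarrow> (real \<times> real \<Rightarrow> nat \<Rightarrow> real) \<Rightarrow> real \<times> real \<Rightarrow> (nat \<Rightarrow> real) \<Rightarrow> bool" where
  "normal_vector m X p N \<longleftrightarrow>
     (\<Sum>k=1..m. N k * pd1 (\<lambda>q. X q k) p) = 0 \<and>
     (\<Sum>k=1..m. N k * pd2 (\<lambda>q. X q k) p) = 0"

text \<open>
  Mean curvature in the normal direction \<open>N\<close>: half the trace, with respect to the first fundamental
  form, of the second fundamental form paired with \<open>N\<close>.
\<close>

definition mean_curvature ::
  "nat \<Rightarrow> (real \<times> real \<Rightarrow> nat \<Rightarrow> real) \<Rightarrow> real \<times> real \<Rightarrow> (nat \<Rightarrow> real) \<Rightarrow> real" where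
  "mean_curvature m X p N =
     (ffG m X p * (\<Sum>k=1..m. N k * pd1 (pd1 (\<lambda>q. X q k)) p)
      - 2 * ffF m X p * (\<Sum>k=1..m. N k * pd1 (pd2 (\<lambda>q. X q k)) p)
      + ffE m X p * (\<Sum>k=1..m. N k * pd2 (pd2 (\<lambda>q. X q k)) p))
     / (2 * (ffE m X p * ffG m X p - (ffF m X p)\<^sup>2))"

definition zero_mean_curvature :: "nat \<Rightarrow> (real \<times> real \<Rightarrow> nat \<Rightarrow> real) \<Rightarrow> bool" where
  "zero_mean_curvature m X \<longleftrightarrow> (\<forall>p N. normal_vector m X p N \<longrightarrow> mean_curvature m X p N = 0)"


definition graph_param :: "nat \<Rightarrow> (nat \<Rightarrow> real \<times> real \<Rightarrow> real) \<Rightarrow> real \<times> real \<Rightarrow> nat \<Rightarrow> real" where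
  "graph_param n f p k =
     (if k = 1 then fst p else if k = 2 then snd p
      else if k \<in> {3..n+2} then f (k - 2) p else 0)"

definition graph_surface :: "nat \<Rightarrow> (nat \<Rightarrow> real \<times> real \<Rightarrow> real) \<Rightarrow> (nat \<Rightarrow> real) set" where
  "graph_surface n f = range (graph_param n f)"

definition minimal_graph :: "nat \<Rightarrow> (nat \<Rightarrow> real \<times> real \<Rightarrow> real) \<Rightarrow> bool" where
  "minimal_graph n f \<longleftrightarrow>
     (\<forall>k\<in>{1..n}. C2_on UNIV (f k)) \<and> zero_mean_curvature (n + 2) (graph_param n f)"


lemma minimal_graph_iff_pde:
  "minimal_graph n f \<longleftrightarrow>
     (\<forall>k\<in>{1..n}. C2_on UNIV (f k)) \<and>
     (\<forall>k\<in>{1..n}. \<forall>p.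
        (1 + (\<Sum>l=1..n. (pd2 (f l) p)\<^sup>2)) * pd1 (pd1 (f k)) p
        - 2 * (\<Sum>l=1..n. pd1 (f l) p * pd2 (f l) p) * pd1 (pd2 (f k)) p
        + (1 + (\<Sum>l=1..n. (pd1 (f l) p)\<^sup>2)) * pd2 (pd2 (f k)) p = 0)"
proof -
  let ?X = "graph_param n f"
  have split: "(\<Sum>k=1..n+2. h k) = h 1 + h 2 + (\<Sum>k=1..n. h (k + 2))" for h :: "nat \<Rightarrow> real"
  proof -
    have "{1..n+2} = {1, 2} \<union> {1+2..n+2}" by auto
    then have "(\<Sum>k=1..n+2. h k) = sum h {1, 2} + sum h {1+2..n+2}"
      by (simp only:) (rule sum.union_disjoint; auto)
    also have "sum h {1+2..n+2} = (\<Sum>k=1..n. h (k + 2))"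
      by (rule sum.shift_bounds_cl_nat_ivl)
    finally show ?thesis by simp
  qed
  have c [simp]: "(\<lambda>q. ?X q 1) = fst" "(\<lambda>q. ?X q (Suc 0)) = fst" "(\<lambda>q. ?X q 2) = snd"
    by (auto simp: graph_param_def)
  have c3: "(\<lambda>q. ?X q (k + 2)) = f k" if "Suc 0 \<le> k" "k \<le> n" for k
    using that by (auto simp: graph_param_def fun_eq_iff)
  have d [simp]: "pd1 fst = (\<lambda>_. 1)" "pd2 fst = (\<lambda>_. 0)" "pd1 snd = (\<lambda>_. 0)" "pd2 snd = (\<lambda>_. 1)"
      "pd1 (\<lambda>_. a) = (\<lambda>_. 0)" "pd2 (\<lambda>_. a) = (\<lambda>_. 0)" for a
    by (auto simp: pd1_def pd2_def fun_eq_iff)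
  have E: "ffE (n+2) ?X p = 1 + (\<Sum>k=1..n. (pd1 (f k) p)\<^sup>2)" for p
    unfolding ffE_def split by (simp add: c3 del: add_2_eq_Suc' cong: sum.cong_simp)
  have F: "ffF (n+2) ?X p = (\<Sum>k=1..n. pd1 (f k) p * pd2 (f k) p)" for p
    unfolding ffF_def split by (simp add: c3 del: add_2_eq_Suc' cong: sum.cong_simp)
  have G: "ffG (n+2) ?X p = 1 + (\<Sum>k=1..n. (pd2 (f k) p)\<^sup>2)" for p
    unfolding ffG_def split by (simp add: c3 del: add_2_eq_Suc' cong: sum.cong_simp)
  have N: "normal_vector (n+2) ?X p N \<longleftrightarrow>
       N 1 + (\<Sum>k=1..n. N (k+2) * pd1 (f k) p) = 0 \<and>
       N 2 + (\<Sum>k=1..n. N (k+2) * pd2 (f k) p) = 0" for p N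
    unfolding normal_vector_def split by (simp add: c3 del: add_2_eq_Suc' cong: sum.cong_simp)
  define L where "L k p = ffG (n+2) ?X p * pd1 (pd1 (f k)) p
        - 2 * ffF (n+2) ?X p * pd1 (pd2 (f k)) p
        + ffE (n+2) ?X p * pd2 (pd2 (f k)) p" for k p
  have W: "ffE (n+2) ?X p * ffG (n+2) ?X p - (ffF (n+2) ?X p)\<^sup>2 > 0" for p
  proof -
    have "(ffF (n+2) ?X p)\<^sup>2 \<le> (\<Sum>k=1..n. (pd1 (f k) p)\<^sup>2) * (\<Sum>k=1..n. (pd2 (f k) p)\<^sup>2)"
      unfolding F by (rule Cauchy_Schwarz_ineq_sum)
    moreover have "(\<Sum>k=1..n. (pd1 (f k) p)\<^sup>2) \<ge> 0" "(\<Sum>k=1..n. (pd2 (f k) p)\<^sup>2) \<ge> 0"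
      by (auto intro: sum_nonneg)
    ultimately show ?thesis unfolding E G by (simp add: algebra_simps)
  qed
  have H: "mean_curvature (n+2) ?X p v = 0 \<longleftrightarrow> (\<Sum>k=1..n. v (k+2) * L k p) = 0" for p v
  proof -
    have "(\<Sum>k=1..n. v (k+2) * L k p) =
         ffG (n+2) ?X p * (\<Sum>k=1..n. v (k+2) * pd1 (pd1 (f k)) p)
         - 2 * ffF (n+2) ?X p * (\<Sum>k=1..n. v (k+2) * pd1 (pd2 (f k)) p)
         + ffE (n+2) ?X p * (\<Sum>k=1..n. v (k+2) * pd2 (pd2 (f k)) p)"
      unfolding L_def
      by (simp add: sum.distrib sum_subtractf sum_distrib_left algebra_simps)
    then show ?thesis
      unfolding mean_curvature_def split using W[of p]
      by (simp add: c3 del: add_2_eq_Suc' cong: sum.cong_simp)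
  qed
  have "zero_mean_curvature (n+2) ?X \<longleftrightarrow> (\<forall>k\<in>{1..n}. \<forall>p. L k p = 0)"
  proof
    assume z: "zero_mean_curvature (n+2) ?X"
    show "\<forall>k\<in>{1..n}. \<forall>p. L k p = 0"
    proof (intro ballI allI)
      fix k p assume k: "k \<in> {1..n}"
      define v :: "nat \<Rightarrow> real" where
        "v l = (if l = 1 then - pd1 (f k) p else if l = 2 then - pd2 (f k) p
                else if l = k + 2 then 1 else 0)" for l
      have v: "v 1 = - pd1 (f k) p" "v 2 = - pd2 (f k) p"
        by (simp_all add: v_def)
      have s: "(\<Sum>l=1..n. v (l+2) * h l) = h k" for h
      proof -
        have "(\<Sum>l=1..n. v (l+2) * h l) = (\<Sum>l=1..n. if l = k then h l else 0)"
          by (rule sum.cong) (auto simp: v_def)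
        then show ?thesis using k by simp
      qed
      have "normal_vector (n+2) ?X p v" unfolding N s v by simp
      then have "(\<Sum>l=1..n. v (l+2) * L l p) = 0"
        using z unfolding zero_mean_curvature_def H by blast
      then show "L k p = 0" unfolding s .
    qed
  next
    assume "\<forall>k\<in>{1..n}. \<forall>p. L k p = 0"
    then show "zero_mean_curvature (n+2) ?X"
      unfolding zero_mean_curvature_def H by simp
  qed
  then show ?thesis unfolding minimal_graph_def L_def E F G by simp
qed


definition hom_coords :: "nat \<Rightarrow> (nat \<Rightarrow> complex) set" where
  "hom_coords d = {z. (\<forall>k. k \<notin> {1..d+1} \<longrightarrow> z k = 0) \<and> (\<exists>k. z k \<noteq> 0)}"

definition proportional :: "nat \<Rightarrow> ((nat \<Rightarrow> complex) \<times> (nat \<Rightarrow> complex)) set" where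
  "proportional d =
     {(z, w). z \<in> hom_coords d \<and> w \<in> hom_coords d \<and> (\<exists>c. c \<noteq> 0 \<and> (\<forall>k. w k = c * z k))}"

definition CP :: "nat \<Rightarrow> (nat \<Rightarrow> complex) set set" where
  "CP d = hom_coords d // proportional d"

definition proj_point :: "nat \<Rightarrow> (nat \<Rightarrow> complex) \<Rightarrow> (nat \<Rightarrow> complex) set" where
  "proj_point d z = proportional d `` {z}"

definition coord_hyperplane :: "nat \<Rightarrow> nat \<Rightarrow> nat \<Rightarrow> complex \<Rightarrow> (nat \<Rightarrow> complex) set set" where
  "coord_hyperplane d i j c = {P \<in> CP d. \<forall>z\<in>P. z i = c * z j}"

text \<open>
  Inverses of local conformal parameters on the graph. Since the graph is oriented by the parameters
  \<open>(x, y)\<close>, which are its first two coordinates, compatibility with the orientation is positivity of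
  the Jacobian of these coordinates.
\<close>

definition conformal_param ::
  "nat \<Rightarrow> (nat \<Rightarrow> real \<times> real \<Rightarrow> real) \<Rightarrow> (real \<times> real) set \<Rightarrow>
   (real \<times> real \<Rightarrow> nat \<Rightarrow> real) \<Rightarrow> bool" where
  "conformal_param n f U X \<longleftrightarrow>
     open U \<and> inj_on X U \<and> X ` U \<subseteq> graph_surface n f \<and>
     (\<forall>k\<in>{1..n+2}. harmonic_on U (\<lambda>q. X q k)) \<and>
     (\<forall>\<xi>\<in>U. ffE (n + 2) X \<xi> = ffG (n + 2) X \<xi> \<and> ffE (n + 2) X \<xi> > 0 \<and> ffF (n + 2) X \<xi> = 0) \<and>
     (\<forall>\<xi>\<in>U. jacobian_det (\<lambda>q. X q 1) (\<lambda>q. X q 2) \<xi> > 0)"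

definition gauss_vector ::
  "nat \<Rightarrow> (real \<times> real \<Rightarrow> nat \<Rightarrow> real) \<Rightarrow> real \<times> real \<Rightarrow> nat \<Rightarrow> complex" where
  "gauss_vector n X \<xi> k =
     (if k \<in> {1..n+2}
      then complex_of_real (pd1 (\<lambda>q. X q k) \<xi>) + \<i> * complex_of_real (pd2 (\<lambda>q. X q k) \<xi>)
      else 0)"

text \<open>
  The class of the Gauss vector in the complex projective space of dimension \<open>n + 1\<close> does not depend
  on the conformal parametrization near \<open>q\<close>, which justifies the definite description.
\<close>

definition gauss_map ::
  "nat \<Rightarrow> (nat \<Rightarrow> real \<times> real \<Rightarrow> real) \<Rightarrow> (nat \<Rightarrow> real) \<Rightarrow> (nat \<Rightarrow> complex) set" where
  "gauss_map n f q =
     (THE L. \<exists>U X \<xi>. conformal_param n f U X \<and> \<xi> \<in> U \<and> X \<xi> = q \<and>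
                     L = proj_point (n + 1) (gauss_vector n X \<xi>))"

end

theory Submission
  imports Defs "HOL-Complex_Analysis.Complex_Analysis"
begin

text \<open>
  Let \<open>lam\<close> be the root in the upper half plane of \<open>E + 2 lam F + lam\<^sup>2 G = 0\<close>, so that the vector
  \<open>phi = X\<^sub>x + lam X\<^sub>y\<close> is isotropic and represents the Gauss map. With \<open>D = \<partial>\<^sub>x + cnj lam \<partial>\<^sub>y\<close>, the minimal
  surface equation says \<open>D phi = (D lam) X\<^sub>y\<close>; applying \<open>D\<close> to \<open>\<Sum>k. phi\<^sub>k\<^sup>2 = 0\<close> gives \<open>D lam = 0\<close>, and hence
  \<open>D phi = 0\<close>. Functions annihilated by \<open>D\<close> are antiholomorphic in Osserman's global isothermal coordinate,
  which maps the plane onto \<open>\<complex>\<close>, so by Liouville's theorem they are constant as soon as their imaginary part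
  has a strict sign. This applies to \<open>lam\<close>, and to \<open>phi\<^sub>i / phi\<^sub>j\<close> because the sign of its imaginary part is
  opposite to that of the Jacobian.
\<close>

subsection \<open>Partial derivatives on the plane\<close>

text \<open>Total differentiability with both partial derivatives displayed. Values in any normed
  space let one calculus serve real and complex functions; totality gives the chain rule along
  curves.\<close>

definition has_partials ::
  "(real \<times> real \<Rightarrow> 'a::real_normed_vector) \<Rightarrow> 'a \<Rightarrow> 'a \<Rightarrow> real \<times> real \<Rightarrow> bool" where
  "has_partials u a b p \<longleftrightarrow> (u has_derivative (\<lambda>h. fst h *\<^sub>R a + snd h *\<^sub>R b)) (at p)"

lemma has_partials_const [intro]: "has_partials (\<lambda>_. c) 0 0 p"
  by (simp add: has_partials_def)

lemma has_partials_proj: "has_partials fst 1 0 p" "has_partials snd 0 1 p"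
  by (auto simp: has_partials_def intro!: derivative_eq_intros)

lemma has_partials_add:
  "has_partials u a b p \<Longrightarrow> has_partials v c d p \<Longrightarrow>
    has_partials (\<lambda>q. u q + v q) (a + c) (b + d) p"
  unfolding has_partials_def by (drule (1) has_derivative_add) (simp add: algebra_simps)

lemma has_partials_linear:
  assumes "bounded_linear L" and "has_partials u a b p"
  shows "has_partials (\<lambda>q. L (u q)) (L a) (L b) p"
proof -
  interpret bounded_linear L by fact
  show ?thesis using has_derivative[OF assms(2)[unfolded has_partials_def]]
    by (simp add: has_partials_def add scale)
qed

lemma has_partials_Complex:
  assumes "has_partials u a b p" and "has_partials v c d p"
  shows "has_partials (\<lambda>q. Complex (u q) (v q)) (Complex a c) (Complex b d) p"
  using has_partials_add[OF has_partials_linear[OF bounded_linear_of_real assms(1)]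
      has_partials_linear[OF bounded_linear_compose[OF bounded_linear_mult_right[of \<i>] bounded_linear_of_real] assms(2)]]
  by (simp add: Complex_eq)

lemma has_partials_mult:
  fixes u v :: "real \<times> real \<Rightarrow> 'a::real_normed_field"
  shows "has_partials u a b p \<Longrightarrow> has_partials v c d p \<Longrightarrow>
    has_partials (\<lambda>q. u q * v q) (a * v p + u p * c) (b * v p + u p * d) p"
  unfolding has_partials_def by (drule (1) has_derivative_mult) (simp add: algebra_simps)

lemma has_partials_inverse:
  fixes u :: "real \<times> real \<Rightarrow> 'a::real_normed_field"
  shows "has_partials u a b p \<Longrightarrow> u p \<noteq> 0 \<Longrightarrow>
    has_partials (\<lambda>q. inverse (u q)) (- a / (u p)\<^sup>2) (- b / (u p)\<^sup>2) p"
  unfolding has_partials_def by (drule (1) Deriv.has_derivative_inverse)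
    (simp add: algebra_simps power2_eq_square divide_inverse)

lemma has_partials_sum:
  assumes "\<And>k. k \<in> A \<Longrightarrow> has_partials (u k) (a k) (b k) p"
  shows "has_partials (\<lambda>q. \<Sum>k\<in>A. u k q) (\<Sum>k\<in>A. a k) (\<Sum>k\<in>A. b k) p"
  using assms by (induction A rule: infinite_finite_induct) (auto intro: has_partials_add)

lemma has_partials_sqrt:
  assumes "has_partials u a b p" and "u p > 0"
  shows "has_partials (\<lambda>q. sqrt (u q)) (a / (2 * sqrt (u p))) (b / (2 * sqrt (u p))) p"
proof -
  have "(\<lambda>h. (fst h *\<^sub>R a + snd h *\<^sub>R b) * (inverse (sqrt (u p)) / 2))
      = (\<lambda>h. fst h *\<^sub>R (a / (2 * sqrt (u p))) + snd h *\<^sub>R (b / (2 * sqrt (u p))))"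
    by (simp add: fun_eq_iff field_simps) (simp add: add_divide_distrib)
  then show ?thesis
    using DERIV_compose_FDERIV[where f=sqrt and g=u, OF DERIV_real_sqrt[OF assms(2)] assms(1)[unfolded has_partials_def]]
    by (simp only: has_partials_def)
qed

lemma has_partials_unique:
  assumes "has_partials u a b p" and "has_partials u c d p"
  shows "a = c" and "b = d"
proof -
  have *: "(\<lambda>h::real \<times> real. fst h *\<^sub>R a + snd h *\<^sub>R b) = (\<lambda>h. fst h *\<^sub>R c + snd h *\<^sub>R d)"
    using assms unfolding has_partials_def by (rule has_derivative_unique)
  show "a = c" "b = d" using fun_cong[OF *, of "(1,0)"] fun_cong[OF *, of "(0,1)"] by simp_all
qed

lemma has_partials_isCont: "has_partials u a b p \<Longrightarrow> isCont u p"
  unfolding has_partials_def by (rule has_derivative_continuous)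

lemma has_partials_curve:
  assumes "has_partials u a b (g t, h t)"
    and "(g has_vector_derivative g') (at t)" and "(h has_vector_derivative h') (at t)"
  shows "((\<lambda>s. u (g s, h s)) has_vector_derivative g' *\<^sub>R a + h' *\<^sub>R b) (at t)"
proof -
  have "((\<lambda>s. (g s, h s)) has_derivative (\<lambda>s. (s *\<^sub>R g', s *\<^sub>R h'))) (at t)"
    using assms(2,3) unfolding has_vector_derivative_def by (rule has_derivative_Pair)
  from has_derivative_compose[OF this assms(1)[unfolded has_partials_def]]
  show ?thesis by (simp add: has_vector_derivative_def algebra_simps)
qed

lemma has_partials_fst_slice:
  assumes "has_partials u a b (x, y)"
  shows "((\<lambda>t. u (t, y)) has_vector_derivative a) (at x)"
  using has_partials_curve[where t=x and g = "\<lambda>t. t" and h="\<lambda>t. y" and g'=1 and h'=0, OF assms] by auto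

lemma has_partials_snd_slice:
  assumes "has_partials u a b (x, y)"
  shows "((\<lambda>t. u (x, t)) has_vector_derivative b) (at y)"
  using has_partials_curve[where t=y and g = "\<lambda>t. x" and h="\<lambda>t. t" and g'=0 and h'=1, OF assms] by auto

text \<open>The increment splits into one in x at fixed y and one in y at nearby x; continuity of
  \<open>b\<close> controls the second.\<close>

lemma has_partialsI:
  assumes x: "\<And>x y. ((\<lambda>t. u (t, y)) has_vector_derivative a (x, y)) (at x)"
    and y: "\<And>x y. ((\<lambda>t. u (x, t)) has_vector_derivative b (x, y)) (at y)"
    and b: "continuous_on UNIV b"
  shows "has_partials u (a p) (b p) p"
proof -
  obtain x y where p: "p = (x, y)" by force
  have "((\<lambda>(x, y). u (x, y)) has_derivative
      (\<lambda>(tx, ty). tx *\<^sub>R a (x, y) + blinfun_scaleR_left (b (x, y)) ty)) (at (x, y) within UNIV \<times> UNIV)"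
  proof (rule has_derivative_partialsI[where fy = "\<lambda>x y. blinfun_scaleR_left (b (x, y))"])
    show "((\<lambda>x. u (x, y)) has_derivative (\<lambda>h. h *\<^sub>R a (x, y))) (at x within UNIV)"
      using x by (simp add: has_vector_derivative_def)
    show "((\<lambda>y. u (x, y)) has_derivative blinfun_apply (blinfun_scaleR_left (b (x, y)))) (at y within UNIV)" for x y
      using y by (simp add: has_vector_derivative_def)
    have "continuous (at (x, y)) (\<lambda>p. blinfun_scaleR_left (b p))"
      using b by (intro bounded_linear.continuous[OF bounded_linear_blinfun_scaleR_left])
        (simp add: continuous_on_eq_continuous_at)
    then show "continuous (at (x, y) within UNIV \<times> UNIV) (\<lambda>(x, y). blinfun_scaleR_left (b (x, y)))"
      by (simp add: case_prod_unfold)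
  qed auto
  then show ?thesis by (simp add: has_partials_def p case_prod_unfold)
qed

section \<open>The class C1 on the whole plane and its closure properties\<close>

lemma C1_on_UNIV_has_partials:
  assumes "C1_on UNIV g"
  shows "has_partials g (pd1 g p) (pd2 g p) p"
proof (rule has_partialsI)
  have "(\<lambda>t. g (t, y)) field_differentiable at x" "(\<lambda>t. g (x, t)) field_differentiable at y" for x y
    using assms unfolding C1_on_def by (metis UNIV_I fst_conv snd_conv)+
  then show "((\<lambda>t. g (t, y)) has_vector_derivative pd1 g (x, y)) (at x)"
    "((\<lambda>t. g (x, t)) has_vector_derivative pd2 g (x, y)) (at y)" for x y
    by (simp_all add: pd1_def pd2_def field_differentiable_derivI
        flip: has_real_derivative_iff_has_vector_derivative)
  show "continuous_on UNIV (pd2 g)" using assms by (simp add: C1_on_def)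
qed

lemma has_partials_pd:
  assumes "has_partials g a b p"
  shows "pd1 g p = a" and "pd2 g p = b"
    and "(\<lambda>t. g (t, snd p)) field_differentiable at (fst p)"
    and "(\<lambda>t. g (fst p, t)) field_differentiable at (snd p)"
proof -
  have *: "((\<lambda>t. g (t, snd p)) has_field_derivative a) (at (fst p))"
    "((\<lambda>t. g (fst p, t)) has_field_derivative b) (at (snd p))"
    using has_partials_fst_slice[of g a b "fst p" "snd p"] has_partials_snd_slice[of g a b "fst p" "snd p"] assms
    by (simp_all add: has_real_derivative_iff_has_vector_derivative)
  then show "pd1 g p = a" "pd2 g p = b" by (simp_all add: pd1_def pd2_def DERIV_imp_deriv)
  show "(\<lambda>t. g (t, snd p)) field_differentiable at (fst p)"
    "(\<lambda>t. g (fst p, t)) field_differentiable at (snd p)"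
    using * by (auto simp: field_differentiable_def)
qed

text \<open>Converse of \<open>C1_on_UNIV_has_partials\<close>. Together they move closure
  properties from \<open>has_partials\<close> to \<open>C1_on UNIV\<close> and give formulas for
  \<open>pd1\<close> and \<open>pd2\<close>.\<close>

lemma C1_on_UNIV_I:
  assumes "\<And>p. has_partials g (a p) (b p) p"
    and "continuous_on UNIV a" and "continuous_on UNIV b"
  shows "C1_on UNIV g" and "pd1 g = a" and "pd2 g = b"
proof -
  show *: "pd1 g = a" "pd2 g = b" using has_partials_pd(1,2)[OF assms(1)] by auto
  show "C1_on UNIV g" unfolding C1_on_def * using has_partials_pd(3,4)[OF assms(1)] assms(2,3) by auto
qed

lemma C1_on_UNIV_continuous: "C1_on UNIV g \<Longrightarrow> continuous_on UNIV g"
  by (intro continuous_at_imp_continuous_on ballI has_partials_isCont[OF C1_on_UNIV_has_partials])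

lemma C1_on_UNIV_continuous_pd:
  "C1_on UNIV g \<Longrightarrow> continuous_on UNIV (pd1 g)" "C1_on UNIV g \<Longrightarrow> continuous_on UNIV (pd2 g)"
  by (simp_all add: C1_on_def)

lemma
  assumes "C1_on UNIV g" and "C1_on UNIV h"
  shows C1_on_UNIV_add: "C1_on UNIV (\<lambda>p. g p + h p)"
    and pd1_add: "pd1 (\<lambda>p. g p + h p) = (\<lambda>p. pd1 g p + pd1 h p)"
proof -
  note * = C1_on_UNIV_I[OF has_partials_add[OF C1_on_UNIV_has_partials[OF assms(1)]
      C1_on_UNIV_has_partials[OF assms(2)]]]
  show "C1_on UNIV (\<lambda>p. g p + h p)" "pd1 (\<lambda>p. g p + h p) = (\<lambda>p. pd1 g p + pd1 h p)"
    by (intro *; intro continuous_intros C1_on_UNIV_continuous_pd assms)+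
qed

lemma C1_on_UNIV_mult:
  assumes "C1_on UNIV g" and "C1_on UNIV h"
  shows "C1_on UNIV (\<lambda>p. g p * h p)"
  by (rule C1_on_UNIV_I[OF has_partials_mult[OF C1_on_UNIV_has_partials[OF assms(1)]
      C1_on_UNIV_has_partials[OF assms(2)]]])
    (intro continuous_intros C1_on_UNIV_continuous_pd C1_on_UNIV_continuous assms)+

lemma C1_on_UNIV_const: "C1_on UNIV (\<lambda>p. c)"
  by (rule C1_on_UNIV_I[OF has_partials_const]) auto

lemma
  assumes "C1_on UNIV g"
  shows C1_on_UNIV_cmult: "C1_on UNIV (\<lambda>p. c * g p)"
    and pd1_cmult: "pd1 (\<lambda>p. c * g p) = (\<lambda>p. c * pd1 g p)"
    and pd2_cmult: "pd2 (\<lambda>p. c * g p) = (\<lambda>p. c * pd2 g p)"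
proof -
  note * = C1_on_UNIV_I[OF has_partials_linear[OF bounded_linear_mult_right[of c] C1_on_UNIV_has_partials[OF assms]]]
  show "C1_on UNIV (\<lambda>p. c * g p)" "pd1 (\<lambda>p. c * g p) = (\<lambda>p. c * pd1 g p)"
    "pd2 (\<lambda>p. c * g p) = (\<lambda>p. c * pd2 g p)"
    by (intro *; intro continuous_intros C1_on_UNIV_continuous_pd assms)+
qed

lemma C1_on_UNIV_sum:
  assumes "\<And>k. k \<in> A \<Longrightarrow> C1_on UNIV (g k)"
  shows "C1_on UNIV (\<lambda>p. \<Sum>k\<in>A. g k p)"
  using assms by (induction A rule: infinite_finite_induct)
    (auto intro: C1_on_UNIV_add C1_on_UNIV_const)

lemma C1_on_UNIV_inverse:
  assumes "C1_on UNIV g" and "\<And>p. g p \<noteq> 0"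
  shows "C1_on UNIV (\<lambda>p. inverse (g p))"
  by (rule C1_on_UNIV_I[OF has_partials_inverse[OF C1_on_UNIV_has_partials[OF assms(1)]]])
    (intro assms continuous_intros C1_on_UNIV_continuous_pd C1_on_UNIV_continuous ballI; simp add: assms)+

lemma C1_on_UNIV_sqrt:
  assumes "C1_on UNIV g" and "\<And>p. g p > 0"
  shows "C1_on UNIV (\<lambda>p. sqrt (g p))"
proof (rule C1_on_UNIV_I[OF has_partials_sqrt[OF C1_on_UNIV_has_partials[OF assms(1)] assms(2)]])
  have [simp]: "g p \<noteq> 0" for p using assms(2)[of p] by simp
  show "continuous_on UNIV (\<lambda>p. pd1 g p / (2 * sqrt (g p)))" "continuous_on UNIV (\<lambda>p. pd2 g p / (2 * sqrt (g p)))"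
    by (intro continuous_intros C1_on_UNIV_continuous_pd C1_on_UNIV_continuous assms; simp)+
qed

text \<open>Differentiating \<open>g (x, s) - g (x, c) = \<integral>\<^sub>c\<^sup>s g\<^sub>y (x, t) dt\<close> first in \<open>x\<close> and then in \<open>s\<close>.\<close>

lemma C2_on_UNIV_mixed:
  assumes "C2_on UNIV g"
  shows "pd2 (pd1 g) p = pd1 (pd2 g) p"
proof -
  obtain x y where p: "p = (x, y)" by force
  obtain c where c: "c < y" using lt_ex by blast
  have C: "C1_on UNIV g" "C1_on UNIV (pd1 g)" "C1_on UNIV (pd2 g)" using assms by (auto simp: C2_on_def)
  have cont: "continuous_on UNIV (pd2 g)" "continuous_on UNIV (pd1 (pd2 g))"
    using C by (auto simp: C1_on_def)
  have I: "integral {c..s} (\<lambda>t. pd1 (pd2 g) (x, t)) = pd1 g (x, s) - pd1 g (x, c)" if "c \<le> s" for s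
  proof -
    have eq: "integral (cbox c s) (\<lambda>t. pd2 g (x', t)) = g (x', s) - g (x', c)" for x'
      using fundamental_theorem_of_calculus[OF that, of "\<lambda>t. g (x', t)" "\<lambda>t. pd2 g (x', t)"]
        has_partials_snd_slice[OF C1_on_UNIV_has_partials[OF C(1)]]
      by (simp add: has_vector_derivative_at_within integral_unique)
    have "((\<lambda>x'. integral (cbox c s) (\<lambda>t. pd2 g (x', t))) has_vector_derivative
        integral (cbox c s) (\<lambda>t. pd1 (pd2 g) (x, t))) (at x within UNIV)"
    proof (rule leibniz_rule_vector_derivative)
      show "((\<lambda>x. pd2 g (x, t)) has_vector_derivative pd1 (pd2 g) (x, t)) (at x within UNIV)" for x t
        using has_partials_fst_slice[OF C1_on_UNIV_has_partials[OF C(3)]] by simp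
      show "(\<lambda>t. pd2 g (x, t)) integrable_on cbox c s" for x
        by (intro integrable_continuous continuous_on_compose2[OF cont(1)] continuous_intros) auto
      show "continuous_on (UNIV \<times> cbox c s) (\<lambda>(x, t). pd1 (pd2 g) (x, t))"
        using continuous_on_subset[OF cont(2)] by simp
    qed auto
    then have "((\<lambda>x'. g (x', s) - g (x', c)) has_vector_derivative
        integral {c..s} (\<lambda>t. pd1 (pd2 g) (x, t))) (at x)"
      unfolding eq by simp
    moreover have "((\<lambda>x'. g (x', s) - g (x', c)) has_vector_derivative pd1 g (x, s) - pd1 g (x, c)) (at x)"
      by (intro has_vector_derivative_diff has_partials_fst_slice[OF C1_on_UNIV_has_partials[OF C(1)]])
    ultimately show ?thesis by (rule vector_derivative_unique_at)
  qed
  have "((\<lambda>s. integral {c..s} (\<lambda>t. pd1 (pd2 g) (x, t))) has_vector_derivative pd1 (pd2 g) (x, y))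
      (at y within {c..y+1})"
    by (rule integral_has_vector_derivative)
      (use c in \<open>auto intro!: continuous_on_compose2[OF cont(2)] continuous_intros\<close>)
  then have "((\<lambda>s. pd1 g (x, s) - pd1 g (x, c)) has_vector_derivative pd1 (pd2 g) (x, y))
      (at y within {c..y+1})"
    by (rule has_vector_derivative_transform[rotated 2]) (use c in \<open>auto simp: I\<close>)
  \<comment> \<open>The derivative within the interval is two-sided, since the choice
    \<open>c < y\<close> makes \<open>y\<close> an interior point.\<close>
  then have "((\<lambda>s. pd1 g (x, s) - pd1 g (x, c)) has_vector_derivative pd1 (pd2 g) (x, y)) (at y)"
    by (subst (asm) at_within_interior) (use c in auto)
  moreover have "((\<lambda>s. pd1 g (x, s) - pd1 g (x, c)) has_vector_derivative pd2 (pd1 g) (x, y) - 0) (at y)"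
    by (intro has_vector_derivative_diff has_vector_derivative_const
        has_partials_snd_slice[OF C1_on_UNIV_has_partials[OF C(2)]])
  ultimately show ?thesis unfolding p by (metis diff_zero vector_derivative_unique_at)
qed

subsection \<open>A Liouville theorem for the complex Burgers equation\<close>

text \<open>Poincare lemma on the plane: the potential of \<open>a dx + b dy\<close> is its integral
  along the segment from the origin. Closedness is expressed by the shared \<open>c\<close>, which
  is both the y-derivative of \<open>a\<close> and the x-derivative of \<open>b\<close>.\<close>

lemma closed_form_has_potential:
  fixes a b :: "real \<times> real \<Rightarrow> 'a::banach"
  assumes a: "\<And>p. has_partials a (ax p) (c p) p"
    and b: "\<And>p. has_partials b (c p) (by p) p"
    and cont: "continuous_on UNIV ax" "continuous_on UNIV c" "continuous_on UNIV by"
  obtains u where "\<And>p. has_partials u (a p) (b p) p"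
proof -
  define w where "w x y t = x *\<^sub>R a (t * x, t * y) + y *\<^sub>R b (t * x, t * y)" for x y t
  define u where "u p = integral (cbox 0 1) (w (fst p) (snd p))" for p
  have conta: "continuous_on UNIV a" and contb: "continuous_on UNIV b"
    by (intro continuous_at_imp_continuous_on ballI has_partials_isCont[OF a] has_partials_isCont[OF b])+
  note [continuous_intros] = continuous_on_compose2[OF conta] continuous_on_compose2[OF contb]
    continuous_on_compose2[OF cont(1)] continuous_on_compose2[OF cont(2)] continuous_on_compose2[OF cont(3)]
  note [derivative_intros] = has_partials_curve[OF a] has_partials_curve[OF b]
  have int: "w x y integrable_on cbox 0 1" for x y
    unfolding w_def by (intro integrable_continuous continuous_intros) auto
  \<comment> \<open>The integrand is the t-derivative of
    \<open>t *\<^sub>R g (t * x, t * y)\<close>. With \<open>g = a\<close> and \<open>g = b\<close>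
    it is, by closedness, what differentiation under the integral sign produces.\<close>
  have ftc: "integral (cbox 0 1) (\<lambda>t. g (t * x, t * y) + t *\<^sub>R (x *\<^sub>R gx (t * x, t * y) + y *\<^sub>R gy (t * x, t * y)))
      = g (x, y)"
    if g: "\<And>p. has_partials g (gx p) (gy p) p" for g gx gy :: "real \<times> real \<Rightarrow> 'a" and x y
  proof -
    have "((\<lambda>t. t *\<^sub>R g (t * x, t * y)) has_vector_derivative
        g (t * x, t * y) + t *\<^sub>R (x *\<^sub>R gx (t * x, t * y) + y *\<^sub>R gy (t * x, t * y))) (at t within {0..1})" for t
      by (rule has_vector_derivative_at_within)
        (auto intro!: derivative_eq_intros has_partials_curve[OF g] has_vector_derivative_real_field simp: add.commute)
    from fundamental_theorem_of_calculus[OF _ this] show ?thesis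
      by (simp add: integral_unique)
  qed
  have "has_partials u (a p) (b p) p" for p
  proof (rule has_partialsI)
    show "((\<lambda>t. u (t, y)) has_vector_derivative a (x, y)) (at x)" for x y
    proof -
      have "((\<lambda>x. integral (cbox 0 1) (w x y)) has_vector_derivative
        integral (cbox 0 1) (\<lambda>t. a (t * x, t * y) + t *\<^sub>R (x *\<^sub>R ax (t * x, t * y) + y *\<^sub>R c (t * x, t * y))))
        (at x within UNIV)"
      proof (rule leibniz_rule_vector_derivative)
        show "((\<lambda>x. w x y t) has_vector_derivative
          a (t * x, t * y) + t *\<^sub>R (x *\<^sub>R ax (t * x, t * y) + y *\<^sub>R c (t * x, t * y))) (at x within UNIV)" for x t
          unfolding w_def
          by (auto intro!: derivative_eq_intros has_vector_derivative_real_field simp: algebra_simps)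
      qed (auto intro!: int[simplified] continuous_intros simp: case_prod_unfold)
      then show ?thesis unfolding u_def using ftc[OF a] by simp
    qed
    show "((\<lambda>t. u (x, t)) has_vector_derivative b (x, y)) (at y)" for x y
    proof -
      have "((\<lambda>y. integral (cbox 0 1) (w x y)) has_vector_derivative
        integral (cbox 0 1) (\<lambda>t. b (t * x, t * y) + t *\<^sub>R (x *\<^sub>R c (t * x, t * y) + y *\<^sub>R by (t * x, t * y))))
        (at y within UNIV)"
      proof (rule leibniz_rule_vector_derivative)
        show "((\<lambda>y. w x y t) has_vector_derivative
          b (t * x, t * y) + t *\<^sub>R (x *\<^sub>R c (t * x, t * y) + y *\<^sub>R by (t * x, t * y))) (at y within UNIV)" for y t
          unfolding w_def
          by (auto intro!: derivative_eq_intros has_vector_derivative_real_field simp: algebra_simps)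
      qed (auto intro!: int[simplified] continuous_intros simp: case_prod_unfold)
      then show ?thesis unfolding u_def using ftc[OF b] by simp
    qed
  qed (rule contb)
  then show thesis by (rule that)
qed

text \<open>The image is closed by completeness and open by invariance of domain.\<close>

lemma expanding_bij:
  fixes f :: "'a::euclidean_space \<Rightarrow> 'b::euclidean_space"
  assumes cont: "continuous_on UNIV f" and exp: "\<And>p q. norm (p - q) \<le> norm (f p - f q)"
    and dim: "DIM('b) \<le> DIM('a)"
  shows "inj f" and "surj f"
proof -
  show inj: "inj f"
  proof (rule injI)
    show "p = q" if "f p = f q" for p q using exp[of p q] that by simp
  qed
  have "open (range f)" using invariance_of_domain_gen[OF open_UNIV cont inj dim] .
  moreover have "closed (range f)"
  proof (rule complete_imp_closed, unfold complete_def, intro allI impI)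
    fix s assume "(\<forall>n. s n \<in> range f) \<and> Cauchy s"
    then have s: "\<And>n. s n \<in> range f" "Cauchy s" by auto
    then have "\<forall>n. \<exists>x. s n = f x" by blast
    then obtain x where x: "\<And>n. s n = f (x n)" by metis
    have "Cauchy x"
      using s(2) exp unfolding Cauchy_def x dist_norm by (meson le_less_trans)
    then obtain l where "x \<longlonglongrightarrow> l" using Cauchy_convergent_iff convergent_def by blast
    then have "s \<longlonglongrightarrow> f l" unfolding x
      using cont continuous_on_tendsto_compose[of UNIV f x l] by (simp add: continuous_on_def)
    then show "\<exists>l\<in>range f. s \<longlonglongrightarrow> l" by blast
  qed
  ultimately show "surj f" using clopen[of "range f"] by simp
qed

text \<open>The values of \<open>f\<close> keep distance at least 1 from \<open>\<i>\<close>, so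
  \<open>inverse (f z - \<i>)\<close> is entire and bounded.\<close>

lemma entire_into_lower_half_plane_constant:
  assumes "f holomorphic_on UNIV" and im: "\<And>z. Im (f z) < 0"
  shows "\<exists>c. \<forall>z. f z = c"
proof -
  have ge: "1 \<le> norm (f z - \<i>)" for z
    using im[of z] abs_Im_le_cmod[of "f z - \<i>"] by simp
  then have nz: "f z - \<i> \<noteq> 0" for z by (metis norm_zero not_one_le_zero)
  have "(\<lambda>z. inverse (f z - \<i>)) holomorphic_on UNIV"
    using assms(1) nz by (intro holomorphic_intros) auto
  moreover have "bounded (range (\<lambda>z. inverse (f z - \<i>)))"
    using ge by (auto simp: bounded_iff norm_inverse intro!: exI[of _ 1] inverse_le_1_iff[THEN iffD2])
  ultimately obtain c where "\<And>z. inverse (f z - \<i>) = c"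
    using Liouville_theorem unfolding constant_on_def by blast
  then have "f z = inverse c + \<i>" for z by (metis diff_add_cancel inverse_inverse_eq)
  then show ?thesis by blast
qed

text \<open>
  The equation for \<open>l\<close> says that the real forms \<open>(\<bar>l\<bar>\<^sup>2 dx - Re l dy) / Im l\<close> and \<open>(dy - Re l dx) / Im l\<close>
  are closed. Adding their potentials to \<open>(x, y)\<close> gives an expanding diffeomorphism \<open>H\<close> onto \<open>\<complex>\<close>
  with \<open>H\<^sub>x + l H\<^sub>y = 0\<close>, so that \<open>u\<^sub>x + cnj l u\<^sub>y = 0\<close> means that \<open>u \<circ> H\<^sup>-\<^sup>1\<close> is antiholomorphic.
\<close>

lemma burgers_liouville:
  fixes l r :: "real \<times> real \<Rightarrow> complex"
  assumes l: "\<And>p. has_partials l (lx p) (ly p) p"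
    and cont: "continuous_on UNIV lx" "continuous_on UNIV ly"
    and Im_l: "\<And>p. Im (l p) > 0"
    and burgers: "\<And>p. lx p + cnj (l p) * ly p = 0"
    and r: "\<And>p. has_partials r (rx p) (ry p) p" "\<And>p. rx p + cnj (l p) * ry p = 0"
    and Im_r: "\<And>p. Im (r p) > 0"
  shows "\<exists>c. \<forall>p. r p = c"
proof -
  define al be where "al p = Re (l p)" and "be p = Im (l p)" for p
  \<comment> \<open>With \<open>l = al + \<i> be\<close> these are 1 / \<open>be\<close>,
    \<open>al / be\<close> and the squared modulus of \<open>l\<close> over \<open>be\<close>: the
    closed forms are \<open>w dx - u dy\<close> and \<open>- u dx + v dy\<close>.\<close>
  define v u w where "v p = inverse (be p)" and "u p = al p * v p" and "w p = al p * u p + be p" for p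
  have be: "be p > 0" for p using Im_l by (simp add: be_def)
  then have be0: "be p \<noteq> 0" for p by (metis less_irrefl)
  have bg: "Re (lx p) = - (al p * Re (ly p) + be p * Im (ly p))"
    "Im (lx p) = be p * Re (ly p) - al p * Im (ly p)" for p
    using burgers[of p] by (simp_all add: complex_eq_iff al_def be_def)
  have al': "has_partials al (Re (lx p)) (Re (ly p)) p" for p
    unfolding al_def by (rule has_partials_linear[OF bounded_linear_Re l])
  have be': "has_partials be (Im (lx p)) (Im (ly p)) p" for p
    unfolding be_def by (rule has_partials_linear[OF bounded_linear_Im l])
  define vx vy where "vx p = - Im (lx p) / (be p)\<^sup>2" and "vy p = - Im (ly p) / (be p)\<^sup>2" for p
  define ux uy where "ux p = Re (lx p) * v p + al p * vx p" and "uy p = Re (ly p) * v p + al p * vy p" for p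
  define wx wy where "wx p = Re (lx p) * u p + al p * ux p + Im (lx p)"
    and "wy p = Re (ly p) * u p + al p * uy p + Im (ly p)" for p
  have v': "has_partials v (vx p) (vy p) p" for p
    unfolding v_def vx_def vy_def by (rule has_partials_inverse[OF be' be0])
  have u': "has_partials u (ux p) (uy p) p" for p
    unfolding u_def ux_def uy_def by (rule has_partials_mult[OF al' v'])
  have w': "has_partials w (wx p) (wy p) p" for p
    unfolding w_def wx_def wy_def by (intro has_partials_add has_partials_mult al' u' be')
  have nu': "has_partials (\<lambda>p. - u p) (- ux p) (- uy p) p" for p
    by (rule has_partials_linear[OF bounded_linear_minus[OF bounded_linear_ident] u'])
  have "continuous_on UNIV al" "continuous_on UNIV be"
    by (intro continuous_at_imp_continuous_on ballI has_partials_isCont[OF al'] has_partials_isCont[OF be'])+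
  note ci = this
  have "continuous_on UNIV v" unfolding v_def by (intro continuous_intros ci) (simp add: be0)
  note ci = ci this
  have "continuous_on UNIV u" unfolding u_def by (intro continuous_intros ci)
  note ci = ci this
  have "continuous_on UNIV vx" "continuous_on UNIV vy"
    unfolding vx_def vy_def by (intro continuous_intros ci cont; simp add: be0)+
  note ci = ci this
  have "continuous_on UNIV ux" "continuous_on UNIV uy"
    unfolding ux_def uy_def by (intro continuous_intros ci cont)+
  note ci = ci this
  have "continuous_on UNIV wx" "continuous_on UNIV wy"
    unfolding wx_def wy_def by (intro continuous_intros ci cont)+
  note ci = ci this
  have vb: "v p * be p = 1" for p by (simp add: v_def be0)
  have vx_eq: "vx p = - Im (lx p) * v p * v p" "vy p = - Im (ly p) * v p * v p" for p
    by (simp_all add: vx_def vy_def v_def power2_eq_square divide_inverse)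
  \<comment> \<open>This is closedness of \<open>- u dx + v dy\<close>, and \<open>wyu\<close> that
    of \<open>w dx - u dy\<close>. After inserting the Burgers equation, what remains carries the
    factor \<open>1 - v p * be p = 0\<close>.\<close>
  have vxu: "vx p = - uy p" for p
  proof -
    have "vx p + uy p = (1 - v p * be p) * Re (ly p) * v p"
      by (simp add: vx_eq uy_def bg algebra_simps)
    then show ?thesis by (simp add: vb)
  qed
  have wyu: "wy p = - ux p" for p
  proof -
    have "wy p + ux p = (1 - v p * be p) * Im (ly p) + al p * (uy p + vx p)"
      by (simp add: wy_def ux_def u_def bg algebra_simps)
    then show ?thesis by (simp add: vb vxu)
  qed
  obtain M where M: "\<And>p. has_partials M (w p) (- u p) p"
    by (rule closed_form_has_potential[of w wx wy "\<lambda>p. - u p" "\<lambda>p. - uy p"])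
      (use w' nu' ci in \<open>auto simp: wyu intro!: continuous_intros\<close>)
  obtain N where N: "\<And>p. has_partials N (- u p) (v p) p"
    by (rule closed_form_has_potential[of "\<lambda>p. - u p" "\<lambda>p. - ux p" vx v vy])
      (use v' nu' ci in \<open>auto simp: vxu intro!: continuous_intros\<close>)
  define H where "H p = Complex (fst p + M p) (snd p + N p)" for p
  define zx zy where "zx p = Complex (1 + w p) (- u p)" and "zy p = Complex (- u p) (1 + v p)" for p
  have H': "has_partials H (zx p) (zy p) p" for p
    using has_partials_Complex[OF has_partials_add[OF has_partials_proj(1) M] has_partials_add[OF has_partials_proj(2) N], of p]
    unfolding H_def zx_def zy_def by simp
  have zxy: "zx p = - l p * zy p" for p
  proof -
    have "l p = Complex (al p) (be p)" by (simp add: al_def be_def)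
    moreover have "be p * u p = al p" using vb[of p] by (simp add: u_def algebra_simps)
    ultimately show ?thesis using vb[of p]
      by (simp add: zx_def zy_def complex_eq_iff w_def u_def algebra_simps)
  qed
  have zy0: "zy p \<noteq> 0" for p
    using be[of p] by (simp add: zy_def complex_eq_iff v_def) (metis add_pos_pos inverse_positive_iff_positive less_irrefl zero_less_one)
  \<comment> \<open>The potential part of \<open>H\<close> has the symmetric Jacobian matrix with
    rows \<open>(w, -u)\<close> and \<open>(-u, v)\<close>, which is positive, so the derivative of
    \<open>H\<close> dominates the identity. The mean value theorem along the segment from
    \<open>q\<close> to \<open>p\<close> and Cauchy-Schwarz turn this into expansion.\<close>
  have exp: "norm (p - q) \<le> norm (H p - H q)" for p q
  proof -
    define d1 d2 where "d1 = fst p - fst q" and "d2 = snd p - snd q"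
    define D where "D = Complex d1 d2"
    have nD: "norm (p - q) = norm D"
      by (simp add: D_def d1_def d2_def norm_prod_def cmod_def)
    define c where "c s = (fst q + s * d1, snd q + s * d2)" for s :: real
    have cur: "((\<lambda>s. H (c s)) has_vector_derivative d1 *\<^sub>R zx (c s) + d2 *\<^sub>R zy (c s)) (at s)" for s
      unfolding c_def by (rule has_partials_curve[OF H']) (auto intro!: derivative_eq_intros)
    have der: "((\<lambda>s. inner D (H (c s))) has_derivative (\<lambda>h. h * inner D (d1 *\<^sub>R zx (c s) + d2 *\<^sub>R zy (c s)))) (at s)" for s
      using has_derivative_inner_right[OF cur[of s, unfolded has_vector_derivative_def], of D] by simp
    obtain s where s: "inner D (H (c 1)) - inner D (H (c 0)) = inner D (d1 *\<^sub>R zx (c s) + d2 *\<^sub>R zy (c s))"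
      using mvt_simple[of 0 1 "\<lambda>s. inner D (H (c s))", OF _ has_derivative_at_withinI[OF der]] by auto
    have c01: "c 1 = p" "c 0 = q" by (simp_all add: c_def d1_def d2_def)
    have "inner D (d1 *\<^sub>R zx (c s) + d2 *\<^sub>R zy (c s))
        = (norm D)\<^sup>2 + (w (c s) * d1\<^sup>2 - 2 * u (c s) * d1 * d2 + v (c s) * d2\<^sup>2)"
      unfolding D_def cmod_power2 by (simp add: zx_def zy_def inner_complex_def power2_eq_square algebra_simps)
    also have "w (c s) * d1\<^sup>2 - 2 * u (c s) * d1 * d2 + v (c s) * d2\<^sup>2
        = v (c s) * (al (c s) * d1 - d2)\<^sup>2 + be (c s) * d1\<^sup>2"
      by (simp add: w_def u_def power2_eq_square algebra_simps)
    finally have "(norm D)\<^sup>2 \<le> inner D (H p - H q)"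
      using be[of "c s"] s[unfolded c01] by (simp add: inner_diff_right v_def)
    also have "\<dots> \<le> norm D * norm (H p - H q)" by (rule norm_cauchy_schwarz)
    finally show ?thesis unfolding nD power2_eq_square
      by (cases "norm D = 0") auto
  qed
  have contH: "continuous_on UNIV H"
    by (intro continuous_at_imp_continuous_on ballI has_partials_isCont[OF H'])
  note bij = expanding_bij[OF contH exp, simplified]
  define G where "G = inv H"
  have HG: "H (G z) = z" for z unfolding G_def by (rule surj_f_inv_f[OF bij(2)])
  \<comment> \<open>Expansion of \<open>H\<close> makes its inverse 1-Lipschitz; the derivative rule
    for inverses requires this continuity.\<close>
  have "norm (G z - G z') \<le> norm (z - z')" for z z'
    using exp[of "G z" "G z'"] by (simp add: HG)
  then have contG: "isCont G z" for z
    by (auto simp: continuous_at_eps_delta dist_norm intro: le_less_trans)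
  have "((\<lambda>z. cnj (r (G z))) has_field_derivative cnj (ry (G z)) / zy (G z)) (at z)" for z
  proof -
    define p where "p = G z"
    \<comment> \<open>The inverse of the differential of \<open>H\<close> at \<open>p\<close>. As
      \<open>zx = - l zy\<close>, that differential sends \<open>h\<close> to
      \<open>k = (snd h - l * fst h) * zy\<close>; the imaginary part of \<open>k / zy\<close>
      recovers \<open>fst h\<close>, then the real part recovers \<open>snd h\<close>.\<close>
    define T where "T k = (- Im (k / zy p) / be p, Re (k / zy p) + al p * (- Im (k / zy p) / be p))" for k
    have "(c *\<^sub>R k) / zy p = c *\<^sub>R (k / zy p)" for c k by (simp add: scaleR_conv_of_real)
    then have "linear T"
      by (intro linearI)
        (auto simp: T_def add_divide_distrib diff_divide_distrib algebra_simps simp del: scaleR_conv_of_real)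
    then have bl: "bounded_linear T" by (simp add: linear_conv_bounded_linear)
    have lp: "l p = Complex (al p) (be p)" by (simp add: al_def be_def)
    have k: "(fst h *\<^sub>R zx p + snd h *\<^sub>R zy p) / zy p = Complex (snd h - al p * fst h) (- be p * fst h)" for h
    proof -
      have "fst h *\<^sub>R zx p + snd h *\<^sub>R zy p = (of_real (snd h) - l p * of_real (fst h)) * zy p"
        by (simp add: zxy scaleR_conv_of_real algebra_simps)
      then have "(fst h *\<^sub>R zx p + snd h *\<^sub>R zy p) / zy p = of_real (snd h) - l p * of_real (fst h)"
        using zy0[of p] by simp
      also have "\<dots> = Complex (snd h - al p * fst h) (- be p * fst h)"
        by (simp add: lp complex_eq_iff)
      finally show ?thesis .
    qed
    have "T \<circ> (\<lambda>h. fst h *\<^sub>R zx p + snd h *\<^sub>R zy p) = id"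
      using be0[of p] by (auto simp: T_def k fun_eq_iff)
    then have "(G has_derivative T) (at z)"
      using H'[unfolded has_partials_def] bl contG HG unfolding p_def
      by (intro has_derivative_inverse_basic[of H _ G z T UNIV]) auto
    moreover have "has_partials (\<lambda>q. cnj (r q)) (cnj (rx p)) (cnj (ry p)) p"
      by (rule has_partials_linear[OF bounded_linear_cnj r(1)])
    ultimately have "((\<lambda>z. cnj (r (G z))) has_derivative
        (\<lambda>k. fst (T k) *\<^sub>R cnj (rx p) + snd (T k) *\<^sub>R cnj (ry p))) (at z)"
      unfolding has_partials_def p_def by (rule has_derivative_compose)
    \<comment> \<open>Conjugating the equation for \<open>r\<close> gives
      \<open>cnj rx = - l * cnj ry\<close>, so the differential depends on \<open>T k\<close> only
      through \<open>snd (T k) - l * fst (T k) = k / zy\<close> and is complex linear in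
      \<open>k\<close>.\<close>
    moreover have "fst (T k) *\<^sub>R cnj (rx p) + snd (T k) *\<^sub>R cnj (ry p) = cnj (ry p) / zy p * k" for k
    proof -
      have "cnj (rx p + cnj (l p) * ry p) = 0" using r(2) by simp
      then have "cnj (rx p) = - l p * cnj (ry p)" by (simp add: eq_neg_iff_add_eq_0)
      then have "fst (T k) *\<^sub>R cnj (rx p) + snd (T k) *\<^sub>R cnj (ry p)
          = cnj (ry p) * (of_real (snd (T k)) - l p * of_real (fst (T k)))"
        by (simp add: scaleR_conv_of_real algebra_simps)
      also have "of_real (snd (T k)) - l p * of_real (fst (T k)) = k / zy p"
        using be0[of p] by (simp add: T_def lp complex_eq_iff)
      finally show ?thesis by simp
    qed
    ultimately show ?thesis by (simp only: has_field_derivative_def p_def)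
  qed
  then have "(\<lambda>z. cnj (r (G z))) holomorphic_on UNIV"
    by (auto simp: holomorphic_on_def field_differentiable_def)
  then obtain c where c: "\<And>z. cnj (r (G z)) = c"
    using entire_into_lower_half_plane_constant[of "\<lambda>z. cnj (r (G z))"] Im_r by auto
  have "r p = cnj c" for p
  proof -
    have "G (H p) = p" by (simp add: G_def inv_f_f[OF bij(1)])
    then show ?thesis using c[of "H p"] by auto
  qed
  then show ?thesis by blast
qed

subsection \<open>Minimal parametrizations of the plane\<close>

text \<open>All \<open>m\<close> coordinates satisfy the same equation. For a graph this includes
  the base coordinates x and y, so the pair of indices in the theorem needs no case
  distinction.\<close>

locale minimal_param =
  fixes m :: nat and X :: "real \<times> real \<Rightarrow> nat \<Rightarrow> real"
  assumes C2: "k \<in> {1..m} \<Longrightarrow> C2_on UNIV (\<lambda>q. X q k)"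
    and nondegenerate: "ffE m X p * ffG m X p - (ffF m X p)\<^sup>2 > 0"
    and pde: "k \<in> {1..m} \<Longrightarrow>
      ffG m X p * pd1 (pd1 (\<lambda>q. X q k)) p - 2 * ffF m X p * pd1 (pd2 (\<lambda>q. X q k)) p
        + ffE m X p * pd2 (pd2 (\<lambda>q. X q k)) p = 0"
begin

text \<open>
  \<open>lam\<close> is the root in the upper half plane of \<open>ffE + 2 lam ffF + lam\<^sup>2 ffG = 0\<close>, that is, the value
  that makes the tangent vector \<open>X\<^sub>x + lam X\<^sub>y\<close> isotropic.
\<close>

definition lam :: "real \<times> real \<Rightarrow> complex" where
  "lam p = Complex (- ffF m X p * inverse (ffG m X p))
     (sqrt (ffE m X p * ffG m X p + - 1 * (ffF m X p * ffF m X p)) * inverse (ffG m X p))"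

definition phi :: "nat \<Rightarrow> real \<times> real \<Rightarrow> complex" where
  "phi k p = complex_of_real (pd1 (\<lambda>q. X q k) p) + lam p * complex_of_real (pd2 (\<lambda>q. X q k) p)"

section \<open>Regularity of \<open>lam\<close> and of the isotropic vector
  \<open>phi\<close>\<close>

lemma C1:
  assumes "k \<in> {1..m}"
  shows "C1_on UNIV (\<lambda>q. X q k)" "C1_on UNIV (pd1 (\<lambda>q. X q k))" "C1_on UNIV (pd2 (\<lambda>q. X q k))"
  using C2[OF assms] by (simp_all add: C2_on_def)

lemma C1_ff: "C1_on UNIV (ffE m X)" "C1_on UNIV (ffF m X)" "C1_on UNIV (ffG m X)"
  unfolding ffE_def[abs_def] ffF_def[abs_def] ffG_def[abs_def] power2_eq_square
  by (intro C1_on_UNIV_sum C1_on_UNIV_mult C1; simp)+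

lemma ffG_pos: "ffG m X p > 0"
proof -
  have "ffE m X p \<ge> 0" "ffG m X p \<ge> 0" by (auto simp: ffE_def ffG_def intro!: sum_nonneg)
  moreover have "ffE m X p * ffG m X p > 0"
    using nondegenerate[of p] zero_le_power2[of "ffF m X p"] by linarith
  ultimately show ?thesis by (simp add: zero_less_mult_iff)
qed

lemma area_pos: "ffE m X p * ffG m X p + - 1 * (ffF m X p * ffF m X p) > 0"
  using nondegenerate[of p] by (simp add: power2_eq_square)

lemma lam_Im: "Im (lam p) > 0"
  using area_pos[of p] ffG_pos[of p] by (simp add: lam_def)

lemma lam_ffG:
  obtains w :: real where "w > 0" and "w\<^sup>2 = ffE m X p * ffG m X p - (ffF m X p)\<^sup>2"
    and "lam p * of_real (ffG m X p) = - of_real (ffF m X p) + \<i> * of_real w"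
proof
  let ?w = "sqrt (ffE m X p * ffG m X p + - 1 * (ffF m X p * ffF m X p))"
  show "?w > 0" using area_pos[of p] by simp
  show "?w\<^sup>2 = ffE m X p * ffG m X p - (ffF m X p)\<^sup>2"
    using area_pos[of p] by (simp add: power2_eq_square)
  show "lam p * of_real (ffG m X p) = - of_real (ffF m X p) + \<i> * of_real ?w"
    using ffG_pos[of p] by (simp add: lam_def complex_eq_iff)
qed

text \<open>The difference and quotients in \<open>lam\<close> are written with sums, products and
  \<open>inverse\<close>, so the closure rules for C1 apply directly; \<open>area_pos\<close> keeps
  the square root away from its singularity.\<close>

lemma C1_lam: "C1_on UNIV (\<lambda>p. Re (lam p))" "C1_on UNIV (\<lambda>p. Im (lam p))"
proof -
  have [simp]: "ffG m X p \<noteq> 0" for p using ffG_pos[of p] by simp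
  have "C1_on UNIV (\<lambda>p. (- 1 * ffF m X p) * inverse (ffG m X p))"
    by (intro C1_on_UNIV_mult C1_on_UNIV_inverse C1_on_UNIV_const C1_ff) simp
  then show "C1_on UNIV (\<lambda>p. Re (lam p))" by (simp add: lam_def)
  have "C1_on UNIV (\<lambda>p. sqrt (ffE m X p * ffG m X p + - 1 * (ffF m X p * ffF m X p)) * inverse (ffG m X p))"
    by (intro C1_on_UNIV_mult C1_on_UNIV_inverse C1_on_UNIV_const C1_ff C1_on_UNIV_sqrt C1_on_UNIV_add area_pos) simp
  then show "C1_on UNIV (\<lambda>p. Im (lam p))" unfolding lam_def complex.sel .
qed

definition lamx where "lamx p = Complex (pd1 (\<lambda>p. Re (lam p)) p) (pd1 (\<lambda>p. Im (lam p)) p)"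
definition lamy where "lamy p = Complex (pd2 (\<lambda>p. Re (lam p)) p) (pd2 (\<lambda>p. Im (lam p)) p)"

lemma lam_partials: "has_partials lam (lamx p) (lamy p) p"
  using has_partials_Complex[OF C1_lam[THEN C1_on_UNIV_has_partials]]
  by (simp add: lamx_def lamy_def)

lemma continuous_lamx: "continuous_on UNIV lamx" "continuous_on UNIV lamy"
proof -
  have eq: "lamx = (\<lambda>p. of_real (pd1 (\<lambda>p. Re (lam p)) p) + \<i> * of_real (pd1 (\<lambda>p. Im (lam p)) p))"
    "lamy = (\<lambda>p. of_real (pd2 (\<lambda>p. Re (lam p)) p) + \<i> * of_real (pd2 (\<lambda>p. Im (lam p)) p))"
    by (simp_all add: fun_eq_iff lamx_def lamy_def Complex_eq)
  show "continuous_on UNIV lamx" "continuous_on UNIV lamy" unfolding eq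
    by (intro continuous_intros C1_on_UNIV_continuous_pd C1_lam)+
qed

definition phix where
  "phix k p = of_real (pd1 (pd1 (\<lambda>q. X q k)) p) +
     (lamx p * of_real (pd2 (\<lambda>q. X q k) p) + lam p * of_real (pd1 (pd2 (\<lambda>q. X q k)) p))"
definition phiy where
  "phiy k p = of_real (pd2 (pd1 (\<lambda>q. X q k)) p) +
     (lamy p * of_real (pd2 (\<lambda>q. X q k) p) + lam p * of_real (pd2 (pd2 (\<lambda>q. X q k)) p))"

lemma phi_partials:
  assumes "k \<in> {1..m}"
  shows "has_partials (phi k) (phix k p) (phiy k p) p"
  unfolding phi_def[abs_def] phix_def phiy_def
  by (intro has_partials_add has_partials_mult lam_partials
      has_partials_linear[OF bounded_linear_of_real] C1_on_UNIV_has_partials C1 assms)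

text \<open>Multiplying by \<open>ffG\<close> and completing the square reduces the equation to
  \<open>lam_ffG\<close>.\<close>

lemma lam_quadratic:
  "of_real (ffE m X p) + 2 * lam p * of_real (ffF m X p) + (lam p)\<^sup>2 * of_real (ffG m X p) = 0"
proof -
  obtain w :: real where w: "w\<^sup>2 = ffE m X p * ffG m X p - (ffF m X p)\<^sup>2"
    and l: "lam p * of_real (ffG m X p) = - of_real (ffF m X p) + \<i> * of_real w"
    using lam_ffG by blast
  let ?E = "complex_of_real (ffE m X p)" and ?F = "complex_of_real (ffF m X p)"
    and ?G = "complex_of_real (ffG m X p)" and ?w = "complex_of_real w"
  have w': "?w\<^sup>2 = ?E * ?G - ?F\<^sup>2" using arg_cong[OF w, of complex_of_real] by simp
  have "?G * (?E + 2 * lam p * ?F + (lam p)\<^sup>2 * ?G) = ?E * ?G + 2 * (lam p * ?G) * ?F + (lam p * ?G)\<^sup>2"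
    by (simp add: power2_eq_square algebra_simps)
  also have "\<dots> = ?E * ?G - ?F\<^sup>2 - ?w\<^sup>2"
    unfolding l by (simp add: power2_eq_square algebra_simps)
  also have "\<dots> = 0" unfolding w' by simp
  finally show ?thesis using ffG_pos[of p] by simp
qed

lemma sum_phi_squares: "(\<Sum>k=1..m. (phi k p)\<^sup>2) = 0"
proof -
  have "(\<Sum>k=1..m. (phi k p)\<^sup>2)
      = of_real (ffE m X p) + 2 * lam p * of_real (ffF m X p) + (lam p)\<^sup>2 * of_real (ffG m X p)"
    by (simp add: phi_def ffE_def ffF_def ffG_def sum_distrib_left power2_eq_square algebra_simps
        flip: sum.distrib)
  then show ?thesis by (simp add: lam_quadratic)
qed

text \<open>The sum equals \<open>ffF + lam * ffG\<close>, which is \<open>\<i>\<close> times the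
  positive area density. This is the factor to be cancelled in deriving the Burgers
  equation.\<close>

lemma sum_phi_pd2: "(\<Sum>k=1..m. phi k p * of_real (pd2 (\<lambda>q. X q k) p)) \<noteq> 0"
proof -
  obtain w :: real where w: "w > 0"
    and l: "lam p * of_real (ffG m X p) = - of_real (ffF m X p) + \<i> * of_real w"
    using lam_ffG by blast
  have "(\<Sum>k=1..m. phi k p * of_real (pd2 (\<lambda>q. X q k) p))
      = of_real (ffF m X p) + lam p * of_real (ffG m X p)"
    by (simp add: phi_def ffF_def ffG_def sum_distrib_left power2_eq_square algebra_simps
        flip: sum.distrib)
  with w show ?thesis unfolding l by simp
qed

text \<open>Vieta's relations for the real quadratic with roots \<open>lam\<close> and
  \<open>cnj lam\<close>.\<close>

lemma lam_add_mult_cnj: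
  "of_real (ffG m X p) * (lam p + cnj (lam p)) = - 2 * of_real (ffF m X p)"
  "of_real (ffG m X p) * (lam p * cnj (lam p)) = of_real (ffE m X p)"
proof -
  let ?E = "ffE m X p" and ?F = "ffF m X p" and ?G = "ffG m X p" and ?a = "Re (lam p)" and ?b = "Im (lam p)"
  obtain w :: real where w: "w\<^sup>2 = ?E * ?G - ?F\<^sup>2"
    and l: "lam p * of_real ?G = - of_real ?F + \<i> * of_real w"
    using lam_ffG by blast
  have ab: "?a * ?G = - ?F" "?b * ?G = w"
    using arg_cong[OF l, of Re] arg_cong[OF l, of Im] by simp_all
  show "of_real ?G * (lam p + cnj (lam p)) = - 2 * of_real ?F"
    using ab(1) by (simp add: complex_eq_iff algebra_simps)
  have "?G * (?G * (?a\<^sup>2 + ?b\<^sup>2)) = (?a * ?G)\<^sup>2 + (?b * ?G)\<^sup>2"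
    by (simp add: power2_eq_square algebra_simps)
  also have "\<dots> = ?G * ?E" unfolding ab w by simp
  finally have "?G * (?a\<^sup>2 + ?b\<^sup>2) = ?E" using ffG_pos[of p] by simp
  then show "of_real ?G * (lam p * cnj (lam p)) = of_real ?E"
    unfolding complex_mult_cnj by (metis of_real_mult)
qed

text \<open>By Vieta, the minimal surface operator divided by \<open>ffG\<close> has the symbol of
  (\<open>\<partial>\<^sub>x + lam \<partial>\<^sub>y\<close>)(\<open>\<partial>\<^sub>x + cnj lam \<partial>\<^sub>y\<close>).\<close>

lemma pde_lam:
  assumes "k \<in> {1..m}"
  shows "of_real (pd1 (pd1 (\<lambda>q. X q k)) p) + (lam p + cnj (lam p)) * of_real (pd1 (pd2 (\<lambda>q. X q k)) p)
    + lam p * cnj (lam p) * of_real (pd2 (pd2 (\<lambda>q. X q k)) p) = (0 :: complex)"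
proof -
  let ?xx = "pd1 (pd1 (\<lambda>q. X q k)) p" and ?xy = "pd1 (pd2 (\<lambda>q. X q k)) p"
    and ?yy = "pd2 (pd2 (\<lambda>q. X q k)) p" and ?G = "complex_of_real (ffG m X p)"
  have "?G * (of_real ?xx + (lam p + cnj (lam p)) * of_real ?xy + lam p * cnj (lam p) * of_real ?yy)
     = ?G * of_real ?xx + (?G * (lam p + cnj (lam p))) * of_real ?xy + (?G * (lam p * cnj (lam p))) * of_real ?yy"
    by (simp add: algebra_simps)
  also have "\<dots> = of_real (ffG m X p * ?xx - 2 * ffF m X p * ?xy + ffE m X p * ?yy)"
    unfolding lam_add_mult_cnj by simp
  also have "\<dots> = 0" using pde[OF assms] by simp
  finally show ?thesis using ffG_pos[of p] by simp
qed

text \<open>Once the mixed derivatives are identified, all second derivatives of \<open>X\<close>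
  cancel by \<open>pde_lam\<close>; only the term where the operator hits \<open>lam\<close>
  survives.\<close>

lemma D_phi:
  assumes "k \<in> {1..m}"
  shows "phix k p + cnj (lam p) * phiy k p
    = (lamx p + cnj (lam p) * lamy p) * of_real (pd2 (\<lambda>q. X q k) p)"
proof -
  have "phix k p + cnj (lam p) * phiy k p
    = (lamx p + cnj (lam p) * lamy p) * of_real (pd2 (\<lambda>q. X q k) p) +
      (of_real (pd1 (pd1 (\<lambda>q. X q k)) p) + (lam p + cnj (lam p)) * of_real (pd1 (pd2 (\<lambda>q. X q k)) p)
       + lam p * cnj (lam p) * of_real (pd2 (pd2 (\<lambda>q. X q k)) p))"
    unfolding phix_def phiy_def C2_on_UNIV_mixed[OF C2[OF assms]] by (simp add: algebra_simps)
  then show ?thesis by (simp add: pde_lam[OF assms])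
qed

text \<open>
  Apply \<open>D = \<partial>\<^sub>x + cnj lam \<partial>\<^sub>y\<close> to \<open>\<Sum>k. phi k\<^sup>2 = 0\<close>: by \<open>D_phi\<close> the result is \<open>D lam\<close> times a nonzero factor.
\<close>

lemma lam_burgers: "lamx p + cnj (lam p) * lamy p = 0"
proof -
  let ?D = "lamx p + cnj (lam p) * lamy p"
  have "has_partials (\<lambda>q. \<Sum>k=1..m. phi k q * phi k q)
      (\<Sum>k=1..m. phix k p * phi k p + phi k p * phix k p)
      (\<Sum>k=1..m. phiy k p * phi k p + phi k p * phiy k p) p"
    by (intro has_partials_sum has_partials_mult phi_partials)
  moreover have "(\<lambda>q. \<Sum>k=1..m. phi k q * phi k q) = (\<lambda>q. 0)"
    using sum_phi_squares by (simp add: power2_eq_square)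
  ultimately have "has_partials (\<lambda>q::real\<times>real. 0::complex)
      (\<Sum>k=1..m. phix k p * phi k p + phi k p * phix k p)
      (\<Sum>k=1..m. phiy k p * phi k p + phi k p * phiy k p) p" by simp
  from has_partials_unique[OF this has_partials_const]
  have "0 = (\<Sum>k=1..m. phix k p * phi k p + phi k p * phix k p)
      + cnj (lam p) * (\<Sum>k=1..m. phiy k p * phi k p + phi k p * phiy k p)" by simp
  also have "\<dots> = (\<Sum>k=1..m. 2 * phi k p * (phix k p + cnj (lam p) * phiy k p))"
    by (simp add: sum_distrib_left algebra_simps flip: sum.distrib)
  also have "\<dots> = (\<Sum>k=1..m. 2 * ?D * (phi k p * of_real (pd2 (\<lambda>q. X q k) p)))"
    by (rule sum.cong) (simp_all add: D_phi)
  also have "\<dots> = 2 * ?D * (\<Sum>k=1..m. phi k p * of_real (pd2 (\<lambda>q. X q k) p))"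
    by (simp add: sum_distrib_left)
  finally have "2 * ?D * (\<Sum>k=1..m. phi k p * of_real (pd2 (\<lambda>q. X q k) p)) = 0" by (rule sym)
  then show ?thesis
    using sum_phi_pd2[of p] by (simp only: mult_eq_0_iff zero_neq_numeral[symmetric] simp_thms)
qed

text \<open>The equation is linear in \<open>r\<close>, so the negative case follows by passing to
  \<open>- r\<close>.\<close>

lemma constant_if_Im_sign:
  assumes "\<And>p. has_partials r (rx p) (ry p) p" and "\<And>p. rx p + cnj (lam p) * ry p = 0"
    and "(\<forall>p. Im (r p) > 0) \<or> (\<forall>p. Im (r p) < 0)"
  shows "\<exists>c. \<forall>p. r p = c"
  using assms(3)
proof
  assume "\<forall>p. Im (r p) > 0"
  then show ?thesis
    using burgers_liouville[OF lam_partials continuous_lamx lam_Im lam_burgers assms(1,2)] by blast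
next
  assume neg: "\<forall>p. Im (r p) < 0"
  have "Im (- r p) > 0" for p using neg[rule_format, of p] by simp
  note 1 = this
  have 2: "has_partials (\<lambda>p. - r p) (- rx p) (- ry p) p" for p
    by (rule has_partials_linear[OF bounded_linear_minus[OF bounded_linear_ident] assms(1)])
  have 3: "- rx p + cnj (lam p) * - ry p = 0" for p
  proof -
    have "- rx p + cnj (lam p) * - ry p = - (rx p + cnj (lam p) * ry p)" by simp
    then show ?thesis unfolding assms(2) by simp
  qed
  obtain c where "\<And>p. - r p = c"
    using burgers_liouville[OF lam_partials continuous_lamx lam_Im lam_burgers 2 3 1] by blast
  then show ?thesis by (metis minus_minus)
qed

text \<open>Here \<open>lam\<close> is both the coefficient and the solution of the
  equation.\<close>

lemma lam_constant: "\<exists>c. \<forall>p. lam p = c"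
  using constant_if_Im_sign[OF lam_partials lam_burgers] lam_Im by blast

lemma phi_ratio_constant:
  assumes ij: "i \<in> {1..m}" "j \<in> {1..m}"
    and J: "(\<forall>p. jacobian_det (\<lambda>q. X q i) (\<lambda>q. X q j) p > 0) \<or>
      (\<forall>p. jacobian_det (\<lambda>q. X q i) (\<lambda>q. X q j) p < 0)"
  shows "\<exists>mu. mu \<notin> \<real> \<and> (\<forall>p. phi i p = mu * phi j p)"
proof -
  let ?J = "jacobian_det (\<lambda>q. X q i) (\<lambda>q. X q j)"
  define r where "r p = phi i p * inverse (phi j p)" for p
  \<comment> \<open>In the product, the term free of \<open>lam\<close> and the one with
    \<open>lam * cnj lam\<close> are real; the cross terms give the Jacobian. This also shows that
    \<open>phi j\<close> has no zeros.\<close>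
  have Im: "Im (phi i p * cnj (phi j p)) = - Im (lam p) * ?J p" for p
    by (simp add: phi_def jacobian_det_def algebra_simps)
  have J0: "?J p \<noteq> 0" for p using J less_irrefl by metis
  have nz: "phi j p \<noteq> 0" for p
    using Im[of p] J0[of p] lam_Im[of p] by auto
  have Im_r: "Im (r p) = Im (lam p) / (norm (phi j p))\<^sup>2 * - ?J p" for p
  proof -
    have "r p = phi i p * cnj (phi j p) / of_real ((norm (phi j p))\<^sup>2)"
      unfolding r_def by (metis complex_div_cnj divide_inverse)
    then have "Im (r p) = Im (phi i p * cnj (phi j p)) / (norm (phi j p))\<^sup>2"
      by (simp only: Im_divide_of_real)
    then show ?thesis unfolding Im by simp
  qed
  have pos: "Im (lam p) / (norm (phi j p))\<^sup>2 > 0" for p using lam_Im nz by simp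
  define rx ry where
    "rx p = phix i p * inverse (phi j p) + phi i p * (- phix j p / (phi j p)\<^sup>2)"
    and "ry p = phiy i p * inverse (phi j p) + phi i p * (- phiy j p / (phi j p)\<^sup>2)" for p
  have "has_partials r (rx p) (ry p) p" for p
    unfolding r_def rx_def ry_def
    by (intro has_partials_mult has_partials_inverse phi_partials ij nz)
  moreover have "rx p + cnj (lam p) * ry p = 0" for p
  proof -
    \<comment> \<open>Since \<open>lam\<close> solves the Burgers equation, \<open>D_phi\<close>
      becomes annihilation of each \<open>phi k\<close>; the quotient rule passes this to the
      ratio.\<close>
    have D: "phix k p + cnj (lam p) * phiy k p = 0" if "k \<in> {1..m}" for k
      using D_phi[OF that] by (simp add: lam_burgers)
    have "rx p + cnj (lam p) * ry p = (phix i p + cnj (lam p) * phiy i p) * inverse (phi j p)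
        - phi i p * (phix j p + cnj (lam p) * phiy j p) / (phi j p)\<^sup>2"
      by (simp add: rx_def ry_def algebra_simps add_divide_distrib)
    then show ?thesis unfolding D[OF ij(1)] D[OF ij(2)] by simp
  qed
  moreover have "(\<forall>p. Im (r p) > 0) \<or> (\<forall>p. Im (r p) < 0)"
    using J unfolding Im_r by (meson mult_pos_neg mult_pos_pos neg_0_less_iff_less neg_less_0_iff_less pos)
  ultimately obtain mu where mu: "\<And>p. r p = mu" using constant_if_Im_sign[of r rx ry] by blast
  have "Im mu \<noteq> 0" using pos J0 unfolding mu[symmetric, of "(0,0)"] Im_r by (metis less_irrefl mult_eq_0_iff neg_equal_0_iff_equal)
  then have "mu \<notin> \<real>" by (auto simp: complex_is_Real_iff)
  moreover have "phi i p = mu * phi j p" for p using mu[of p] nz[of p] by (auto simp: r_def)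
  ultimately show ?thesis by blast
qed

end

subsection \<open>Gauss map of a minimal graph\<close>

text \<open>Links conformality with isotropy of the Gauss vector. It is read in one direction for
  given conformal parameters and in the other to verify conformality of the constructed one.\<close>

lemma sum_gauss_vector_squares:
  "(\<Sum>k=1..n+2. (gauss_vector n Y \<xi> k)\<^sup>2)
    = of_real (ffE (n+2) Y \<xi> - ffG (n+2) Y \<xi>) + 2 * \<i> * of_real (ffF (n+2) Y \<xi>)"
proof -
  have "(\<Sum>k=1..n+2. (gauss_vector n Y \<xi> k)\<^sup>2)
    = (\<Sum>k=1..n+2. of_real ((pd1 (\<lambda>q. Y q k) \<xi>)\<^sup>2) - of_real ((pd2 (\<lambda>q. Y q k) \<xi>)\<^sup>2)
        + 2 * \<i> * of_real (pd1 (\<lambda>q. Y q k) \<xi> * pd2 (\<lambda>q. Y q k) \<xi>))"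
    by (rule sum.cong) (simp_all add: gauss_vector_def power2_eq_square algebra_simps)
  also have "\<dots> = of_real (ffE (n+2) Y \<xi> - ffG (n+2) Y \<xi>) + 2 * \<i> * of_real (ffF (n+2) Y \<xi>)"
    unfolding ffE_def ffF_def ffG_def sum.distrib sum_subtractf of_real_diff of_real_sum sum_distrib_left ..
  finally show ?thesis .
qed

section \<open>The graph as a minimal parametrization\<close>

lemma graph_param_1_2: "graph_param n f p 1 = fst p" "graph_param n f p 2 = snd p"
  by (simp_all add: graph_param_def)

lemma graph_param_inj: "graph_param n f p = graph_param n f q \<longleftrightarrow> p = q"
  by (metis graph_param_1_2 prod_eqI)

lemma pd_proj:
  "pd1 fst = (\<lambda>_. 1)" "pd2 fst = (\<lambda>_. 0)" "pd1 snd = (\<lambda>_. 0)" "pd2 snd = (\<lambda>_. 1)"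
  "pd1 (\<lambda>_. a) = (\<lambda>_. 0)" "pd2 (\<lambda>_. a) = (\<lambda>_. 0)"
  by (auto simp: pd1_def pd2_def fun_eq_iff)

lemma C2_on_UNIV_proj: "C2_on UNIV fst" "C2_on UNIV snd"
  using C1_on_UNIV_I(1)[OF has_partials_proj(1)] C1_on_UNIV_I(1)[OF has_partials_proj(2)]
  by (auto simp: C2_on_def pd_proj C1_on_UNIV_const)

lemma graph_param_coords:
  "(\<lambda>q. graph_param n f q 1) = fst" "(\<lambda>q. graph_param n f q 2) = snd"
  "k \<in> {1..n} \<Longrightarrow> (\<lambda>q. graph_param n f q (k + 2)) = f k"
  by (auto simp: graph_param_def fun_eq_iff)

lemma coord_cases:
  fixes k :: nat
  assumes "k \<in> {1..n+2}"
  obtains "k = 1" | "k = 2" | l where "l \<in> {1..n}" "k = l + 2"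
proof -
  consider "k = 1" | "k = 2" | "3 \<le> k" using assms by fastforce
  then show ?thesis
  proof cases
    case 3
    then show ?thesis using assms that(3)[of "k - 2"] by auto
  qed (use that in auto)
qed

lemma minimal_graph_minimal_param:
  assumes "minimal_graph n f"
  shows "minimal_param (n+2) (graph_param n f)"
proof -
  let ?X = "graph_param n f"
  have split: "(\<Sum>k=1..n+2. h k) = h 1 + h 2 + (\<Sum>k=1..n. h (k + 2))" for h :: "nat \<Rightarrow> real"
  proof -
    have "{1..n+2} = {1, 2} \<union> {1+2..n+2}" by auto
    then have "(\<Sum>k=1..n+2. h k) = sum h {1, 2} + sum h {1+2..n+2}"
      by (simp only:) (rule sum.union_disjoint; auto)
    also have "sum h {1+2..n+2} = (\<Sum>k=1..n. h (k + 2))"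
      by (rule sum.shift_bounds_cl_nat_ivl)
    finally show ?thesis by simp
  qed
  have E: "ffE (n+2) ?X p = 1 + (\<Sum>k=1..n. (pd1 (f k) p)\<^sup>2)"
    and F: "ffF (n+2) ?X p = (\<Sum>k=1..n. pd1 (f k) p * pd2 (f k) p)"
    and G: "ffG (n+2) ?X p = 1 + (\<Sum>k=1..n. (pd2 (f k) p)\<^sup>2)" for p
    unfolding ffE_def ffF_def ffG_def split graph_param_coords
    by (simp_all add: graph_param_coords(3) pd_proj del: add_2_eq_Suc' cong: sum.cong_simp)
  have f: "\<And>k. k \<in> {1..n} \<Longrightarrow> C2_on UNIV (f k)"
    "\<And>k p. k \<in> {1..n} \<Longrightarrow> (1 + (\<Sum>l=1..n. (pd2 (f l) p)\<^sup>2)) * pd1 (pd1 (f k)) p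
        - 2 * (\<Sum>l=1..n. pd1 (f l) p * pd2 (f l) p) * pd1 (pd2 (f k)) p
        + (1 + (\<Sum>l=1..n. (pd1 (f l) p)\<^sup>2)) * pd2 (pd2 (f k)) p = 0"
    using assms unfolding minimal_graph_iff_pde by blast+
  show ?thesis
  proof
    show "C2_on UNIV (\<lambda>q. ?X q k)" if "k \<in> {1..n+2}" for k
      using that by (cases rule: coord_cases)
        (simp_all add: graph_param_coords C2_on_UNIV_proj f del: add_2_eq_Suc' One_nat_def)
    show "0 < ffE (n+2) ?X p * ffG (n+2) ?X p - (ffF (n+2) ?X p)\<^sup>2" for p
    proof -
      \<comment> \<open>Cauchy-Schwarz bounds the determinant below by 1, owing to the summands 1 in
        \<open>ffE\<close> and \<open>ffG\<close>.\<close>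
      have "(ffF (n+2) ?X p)\<^sup>2 \<le> (\<Sum>k=1..n. (pd1 (f k) p)\<^sup>2) * (\<Sum>k=1..n. (pd2 (f k) p)\<^sup>2)"
        unfolding F by (rule Cauchy_Schwarz_ineq_sum)
      moreover have "(\<Sum>k=1..n. (pd1 (f k) p)\<^sup>2) \<ge> 0" "(\<Sum>k=1..n. (pd2 (f k) p)\<^sup>2) \<ge> 0"
        by (auto intro: sum_nonneg)
      ultimately show ?thesis unfolding E G by (simp add: algebra_simps)
    qed
    show "ffG (n+2) ?X p * pd1 (pd1 (\<lambda>q. ?X q k)) p - 2 * ffF (n+2) ?X p * pd1 (pd2 (\<lambda>q. ?X q k)) p
        + ffE (n+2) ?X p * pd2 (pd2 (\<lambda>q. ?X q k)) p = 0" if "k \<in> {1..n+2}" for k p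
      using that
    proof (cases rule: coord_cases)
      case (3 l)
      then show ?thesis unfolding E F G using f(2)[of l p]
        by (simp add: graph_param_coords(3) del: add_2_eq_Suc')
    qed (simp_all add: graph_param_coords pd_proj del: One_nat_def)
  qed
qed

text \<open>For constant \<open>lam = al + \<i> be\<close> this linear substitution turns
  \<open>\<partial>\<^sub>1 + \<i> \<partial>\<^sub>2\<close> into
  \<open>\<partial>\<^sub>x + lam \<partial>\<^sub>y\<close>, so it yields a conformal
  parameter.\<close>

definition shear :: "real \<Rightarrow> real \<Rightarrow> real \<times> real \<Rightarrow> real \<times> real" where
  "shear al be q = (fst q, al * fst q + be * snd q)"

lemma
  assumes "C1_on UNIV g"
  shows C1_on_UNIV_shear: "C1_on UNIV (\<lambda>q. g (shear al be q))"
    and pd1_shear: "pd1 (\<lambda>q. g (shear al be q)) = (\<lambda>q. pd1 g (shear al be q) + al * pd2 g (shear al be q))"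
    and pd2_shear: "pd2 (\<lambda>q. g (shear al be q)) = (\<lambda>q. be * pd2 g (shear al be q))"
proof -
  have T: "(shear al be has_derivative shear al be) (at q)" for q
    unfolding shear_def[abs_def] by (auto intro!: derivative_eq_intros)
  have "has_partials (\<lambda>q. g (shear al be q)) (pd1 g (shear al be q) + al * pd2 g (shear al be q)) (be * pd2 g (shear al be q)) q" for q
    using has_derivative_compose[OF T C1_on_UNIV_has_partials[OF assms(1), unfolded has_partials_def]]
    by (simp add: has_partials_def shear_def algebra_simps)
  note * = C1_on_UNIV_I[OF this]
  have "continuous_on UNIV (shear al be)" unfolding shear_def[abs_def] by (intro continuous_intros)
  then have [continuous_intros]: "continuous_on UNIV (\<lambda>q. pd1 g (shear al be q))" "continuous_on UNIV (\<lambda>q. pd2 g (shear al be q))"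
    by (auto intro: continuous_on_compose2 C1_on_UNIV_continuous_pd[OF assms(1)])
  show "C1_on UNIV (\<lambda>q. g (shear al be q))" "pd1 (\<lambda>q. g (shear al be q)) = (\<lambda>q. pd1 g (shear al be q) + al * pd2 g (shear al be q))"
    "pd2 (\<lambda>q. g (shear al be q)) = (\<lambda>q. be * pd2 g (shear al be q))"
    by (intro *; intro continuous_intros)+
qed

context minimal_param
begin

text \<open>The Laplacian in the sheared variables is the operator of \<open>pde_lam\<close>, with
  coefficients \<open>2 * al\<close> and \<open>al\<^sup>2 + be\<^sup>2\<close>.\<close>

lemma harmonic_shear:
  assumes lam: "\<And>p. lam p = Complex al be" and k: "k \<in> {1..m}"
  shows "harmonic_on UNIV (\<lambda>q. X (shear al be q) k)"
    and "of_real (pd1 (\<lambda>q. X (shear al be q) k) q) + \<i> * of_real (pd2 (\<lambda>q. X (shear al be q) k) q) = phi k (shear al be q)"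
proof -
  let ?g = "\<lambda>q. X q k"
  note C = C1[OF k]
  note s1 = pd1_shear[OF C(1), of al be] pd2_shear[OF C(1), of al be]
  note s2 = C1_on_UNIV_shear[OF C(2), of al be]
    pd1_shear[OF C(2), of al be] pd2_shear[OF C(2), of al be]
  note s3 = C1_on_UNIV_shear[OF C(3), of al be]
    pd1_shear[OF C(3), of al be] pd2_shear[OF C(3), of al be]
  have C2': "C2_on UNIV (\<lambda>q. X (shear al be q) k)"
    unfolding C2_on_def s1
    by (intro conjI C1_on_UNIV_add C1_on_UNIV_cmult s2(1) s3(1) C1_on_UNIV_shear[OF C(1), of al be])
  have "pd1 (pd1 (\<lambda>q. X (shear al be q) k)) q + pd2 (pd2 (\<lambda>q. X (shear al be q) k)) q = 0" for q
  proof -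
    have "pd1 (pd1 ?g) (shear al be q) + (2 * al) * pd1 (pd2 ?g) (shear al be q) + (al\<^sup>2 + be\<^sup>2) * pd2 (pd2 ?g) (shear al be q) = 0"
      using arg_cong[OF pde_lam[OF k, of "shear al be q"], of Re]
      by (simp add: lam complex_add_cnj complex_mult_cnj power2_eq_square)
    then show ?thesis
      unfolding s1 pd1_add[OF s2(1) C1_on_UNIV_cmult[OF s3(1)]] pd1_cmult[OF s3(1)] pd2_cmult[OF s3(1)]
        s2 s3 C2_on_UNIV_mixed[OF C2[OF k]]
      by (simp add: power2_eq_square algebra_simps)
  qed
  with C2' show "harmonic_on UNIV (\<lambda>q. X (shear al be q) k)" by (simp add: harmonic_on_def)
  show "of_real (pd1 (\<lambda>q. X (shear al be q) k) q) + \<i> * of_real (pd2 (\<lambda>q. X (shear al be q) k) q) = phi k (shear al be q)"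
    unfolding s1 phi_def lam by (simp add: complex_eq_iff)
qed

end

text \<open>A map into the graph is determined by its first two coordinates, hence \<open>Y\<close>
  is \<open>graph_param\<close> composed with them.\<close>

lemma conformal_param_chain_rule:
  assumes Y: "conformal_param n f U Y" "\<xi> \<in> U" "Y \<xi> = graph_param n f p"
    and k: "k \<in> {1..n+2}"
    and C1: "C1_on UNIV (\<lambda>q. graph_param n f q k)"
  shows "pd1 (\<lambda>q. Y q k) \<xi> = pd1 (\<lambda>q. Y q 1) \<xi> * pd1 (\<lambda>q. graph_param n f q k) p
      + pd1 (\<lambda>q. Y q 2) \<xi> * pd2 (\<lambda>q. graph_param n f q k) p" (is ?A)
    and "pd2 (\<lambda>q. Y q k) \<xi> = pd2 (\<lambda>q. Y q 1) \<xi> * pd1 (\<lambda>q. graph_param n f q k) p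
      + pd2 (\<lambda>q. Y q 2) \<xi> * pd2 (\<lambda>q. graph_param n f q k) p" (is ?B)
proof -
  let ?g = "\<lambda>q. graph_param n f q k"
  obtain a b where \<xi>: "\<xi> = (a, b)" by force
  have U: "open U" and im: "Y ` U \<subseteq> range (graph_param n f)"
    and harm: "\<And>k. k \<in> {1..n+2} \<Longrightarrow> harmonic_on U (\<lambda>q. Y q k)"
    using Y(1) by (auto simp: conformal_param_def graph_surface_def)
  have Yk: "graph_param n f (Y q 1, Y q 2) k = Y q k" if q: "q \<in> U" for q
  proof -
    obtain s where s: "Y q = graph_param n f s" using im q by blast
    have "(Y q 1, Y q 2) = s" unfolding s graph_param_1_2 by simp
    then show ?thesis by (simp add: s)
  qed
  have p: "(Y (a, b) 1, Y (a, b) 2) = p"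
    using Y(3) unfolding \<xi> by (simp only: graph_param_1_2 prod.collapse)
  have "C1_on U (\<lambda>q. Y q l)" if "l \<in> {1..n+2}" for l
    using harm[OF that] by (simp add: harmonic_on_def C2_on_def)
  then have "(\<lambda>t. Y (t, b) l) field_differentiable at a" "(\<lambda>t. Y (a, t) l) field_differentiable at b"
    if "l \<in> {1..n+2}" for l
    using that Y(2) unfolding C1_on_def \<xi> by fastforce+
  then have D: "((\<lambda>t. Y (t, b) l) has_vector_derivative pd1 (\<lambda>q. Y q l) \<xi>) (at a)"
    "((\<lambda>t. Y (a, t) l) has_vector_derivative pd2 (\<lambda>q. Y q l) \<xi>) (at b)" if "l \<in> {1..n+2}" for l
    using that by (simp_all add: \<xi> pd1_def pd2_def field_differentiable_derivI
        flip: has_real_derivative_iff_has_vector_derivative)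
  have 12: "1 \<in> {1..n+2}" "2 \<in> {1..n+2}" by auto
  \<comment> \<open>The factorization \<open>Yk\<close> holds only on \<open>U\<close>; open slices
    suffice to transfer derivatives.\<close>
  have open_slices: "open {t. (t, b) \<in> U}" "open {t. (a, t) \<in> U}"
    using U by (auto intro!: open_vimage[of U, unfolded vimage_def] continuous_intros)
  have g: "has_partials ?g (pd1 ?g p) (pd2 ?g p) (Y (a, b) 1, Y (a, b) 2)"
    unfolding p by (rule C1_on_UNIV_has_partials[OF C1])
  have "((\<lambda>t. graph_param n f (Y (t, b) 1, Y (t, b) 2) k) has_vector_derivative
      pd1 (\<lambda>q. Y q 1) \<xi> *\<^sub>R pd1 ?g p + pd1 (\<lambda>q. Y q 2) \<xi> *\<^sub>R pd2 ?g p) (at a)"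
    by (rule has_partials_curve[OF g D(1)[OF 12(1)] D(1)[OF 12(2)]])
  then have "((\<lambda>t. Y (t, b) k) has_vector_derivative
      pd1 (\<lambda>q. Y q 1) \<xi> *\<^sub>R pd1 ?g p + pd1 (\<lambda>q. Y q 2) \<xi> *\<^sub>R pd2 ?g p) (at a)"
    by (rule has_vector_derivative_transform_within_open[OF _ open_slices(1)])
      (use Y(2) Yk \<xi> in auto)
  from vector_derivative_unique_at[OF D(1)[OF k] this] show ?A by simp
  have "((\<lambda>t. graph_param n f (Y (a, t) 1, Y (a, t) 2) k) has_vector_derivative
      pd2 (\<lambda>q. Y q 1) \<xi> *\<^sub>R pd1 ?g p + pd2 (\<lambda>q. Y q 2) \<xi> *\<^sub>R pd2 ?g p) (at b)"
    by (rule has_partials_curve[OF g D(2)[OF 12(1)] D(2)[OF 12(2)]])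
  then have "((\<lambda>t. Y (a, t) k) has_vector_derivative
      pd2 (\<lambda>q. Y q 1) \<xi> *\<^sub>R pd1 ?g p + pd2 (\<lambda>q. Y q 2) \<xi> *\<^sub>R pd2 ?g p) (at b)"
    by (rule has_vector_derivative_transform_within_open[OF _ open_slices(2)])
      (use Y(2) Yk \<xi> in auto)
  from vector_derivative_unique_at[OF D(2)[OF k] this] show ?B by simp
qed

locale minimal_graph_surface =
  fixes n :: nat and f :: "nat \<Rightarrow> real \<times> real \<Rightarrow> real"
  assumes minimal: "minimal_graph n f"

sublocale minimal_graph_surface \<subseteq> minimal_param "n + 2" "graph_param n f"
  by (rule minimal_graph_minimal_param[OF minimal])

context minimal_graph_surface
begin

text \<open>Cut off outside the index range, as \<open>hom_coords\<close> demands.\<close>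

definition isotropic_vector :: "real \<times> real \<Rightarrow> nat \<Rightarrow> complex" where
  "isotropic_vector p k = (if k \<in> {1..n+2} then phi k p else 0)"

text \<open>
  By the chain rule the Gauss vector is \<open>z\<^sub>1 X\<^sub>x + z\<^sub>2 X\<^sub>y\<close> with \<open>z\<^sub>1, z\<^sub>2\<close> its first two entries.
  Conformality makes it isotropic, so \<open>z\<^sub>2\<close> is \<open>lam z\<^sub>1\<close> or \<open>cnj lam z\<^sub>1\<close>, and the orientation selects \<open>lam\<close>.
\<close>

lemma gauss_vector_eq:
  assumes Y: "conformal_param n f U Y" "\<xi> \<in> U" "Y \<xi> = graph_param n f p"
  shows "\<exists>c. c \<noteq> 0 \<and> gauss_vector n Y \<xi> = (\<lambda>k. c * isotropic_vector p k)"
proof -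
  let ?X = "graph_param n f"
  let ?E = "complex_of_real (ffE (n+2) ?X p)" and ?F = "complex_of_real (ffF (n+2) ?X p)"
    and ?G = "complex_of_real (ffG (n+2) ?X p)"
  define z1 z2 where "z1 = gauss_vector n Y \<xi> 1" and "z2 = gauss_vector n Y \<xi> 2"
  have z: "z1 = of_real (pd1 (\<lambda>q. Y q 1) \<xi>) + \<i> * of_real (pd2 (\<lambda>q. Y q 1) \<xi>)"
    "z2 = of_real (pd1 (\<lambda>q. Y q 2) \<xi>) + \<i> * of_real (pd2 (\<lambda>q. Y q 2) \<xi>)"
    by (auto simp: z1_def z2_def gauss_vector_def)
  have gv: "gauss_vector n Y \<xi> k = z1 * of_real (pd1 (\<lambda>q. ?X q k) p) + z2 * of_real (pd2 (\<lambda>q. ?X q k) p)"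
    if "k \<in> {1..n+2}" for k
    using that conformal_param_chain_rule[OF Y that C1(1)[OF that]]
    unfolding z by (simp add: gauss_vector_def algebra_simps)
  have conf: "ffE (n+2) Y \<xi> = ffG (n+2) Y \<xi>" "ffF (n+2) Y \<xi> = 0"
    and jac: "jacobian_det (\<lambda>q. Y q 1) (\<lambda>q. Y q 2) \<xi> > 0"
    using Y(1,2) by (auto simp: conformal_param_def)
  have jz: "Im (cnj z1 * z2) > 0"
    using jac unfolding jacobian_det_def z by simp
  have "z1\<^sup>2 * ?E + 2 * z1 * z2 * ?F + z2\<^sup>2 * ?G
      = (\<Sum>k=1..n+2. (z1 * of_real (pd1 (\<lambda>q. ?X q k) p) + z2 * of_real (pd2 (\<lambda>q. ?X q k) p))\<^sup>2)"
    unfolding ffE_def ffF_def ffG_def of_real_sum sum_distrib_left sum.distrib[symmetric]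
    by (rule sum.cong) (simp_all add: power2_eq_square algebra_simps)
  also have "\<dots> = (\<Sum>k=1..n+2. (gauss_vector n Y \<xi> k)\<^sup>2)"
    by (rule sum.cong) (simp_all add: gv)
  also have "\<dots> = 0" unfolding sum_gauss_vector_squares conf by simp
  finally have null: "z1\<^sup>2 * ?E + 2 * z1 * z2 * ?F + z2\<^sup>2 * ?G = 0" .
  \<comment> \<open>Vieta factors the isotropy relation into linear factors in
    \<open>z2\<close>.\<close>
  have "?G * ((z2 - lam p * z1) * (z2 - cnj (lam p) * z1))
      = z2\<^sup>2 * ?G - z1 * z2 * (?G * (lam p + cnj (lam p))) + z1\<^sup>2 * (?G * (lam p * cnj (lam p)))"
    by (simp add: power2_eq_square algebra_simps)
  also have "\<dots> = 0" unfolding lam_add_mult_cnj using null by (simp add: algebra_simps)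
  finally have "z2 = lam p * z1 \<or> z2 = cnj (lam p) * z1" using ffG_pos[of p] by simp
  moreover have "z2 \<noteq> cnj (lam p) * z1"
  proof
    assume "z2 = cnj (lam p) * z1"
    then have "cnj z1 * z2 = cnj (lam p) * (z1 * cnj z1)" by simp
    also have "\<dots> = cnj (lam p) * of_real ((cmod z1)\<^sup>2)" by (simp only: complex_norm_square)
    finally have "Im (cnj z1 * z2) = - Im (lam p) * (cmod z1)\<^sup>2" by simp
    also have "\<dots> \<le> 0" using lam_Im[of p] by simp
    finally show False using jz by simp
  qed
  ultimately have z2: "z2 = lam p * z1" by blast
  have "z1 \<noteq> 0" using jz by auto
  moreover have "gauss_vector n Y \<xi> k = z1 * isotropic_vector p k" for k
  proof (cases "k \<in> {1..n+2}")
    case True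
    then show ?thesis unfolding gv[OF True] z2 isotropic_vector_def phi_def if_P[OF True]
      by (simp add: algebra_simps)
  next
    case False
    show ?thesis unfolding gauss_vector_def isotropic_vector_def if_not_P[OF False] by simp
  qed
  ultimately show ?thesis by blast
qed

text \<open>The sheared graph is a global conformal parametrization; it provides existence for the
  definite description of the Gauss map.\<close>

lemma ex_conformal_param:
  obtains Y where "conformal_param n f UNIV Y" and "range Y = graph_surface n f"
proof -
  let ?X = "graph_param n f"
  obtain al be where lam: "\<And>p. lam p = Complex al be"
    using lam_constant by (metis complex.exhaust)
  have be: "be > 0" using lam_Im[of "(0, 0)"] unfolding lam by simp
  define Y where "Y q = ?X (shear al be q)" for q
  have gv: "gauss_vector n Y \<xi> k = phi k (shear al be \<xi>)" if "k \<in> {1..n+2}" for \<xi> k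
    using that harmonic_shear(2)[OF lam that] by (simp add: gauss_vector_def Y_def)
  have "(\<Sum>k=1..n+2. (gauss_vector n Y \<xi> k)\<^sup>2) = (\<Sum>k=1..n+2. (phi k (shear al be \<xi>))\<^sup>2)" for \<xi>
    by (rule sum.cong) (simp_all add: gv)
  then have "of_real (ffE (n+2) Y \<xi> - ffG (n+2) Y \<xi>) + 2 * \<i> * of_real (ffF (n+2) Y \<xi>) = (0::complex)" for \<xi>
    unfolding sum_phi_squares sum_gauss_vector_squares .
  then have conf: "ffE (n+2) Y \<xi> = ffG (n+2) Y \<xi>" "ffF (n+2) Y \<xi> = 0" for \<xi>
    by (simp_all add: complex_eq_iff)
  have Y1: "(\<lambda>q. Y q 1) = fst" and Y2: "(\<lambda>q. Y q 2) = (\<lambda>q. snd (shear al be q))"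
    unfolding Y_def graph_param_1_2 by (simp_all add: shear_def)
  have "(pd1 (\<lambda>q. Y q 1) \<xi>)\<^sup>2 \<le> ffE (n+2) Y \<xi>" for \<xi>
    unfolding ffE_def by (rule member_le_sum) auto
  then have E: "ffE (n+2) Y \<xi> > 0" for \<xi>
    unfolding Y1 pd_proj by (simp add: less_le_trans[OF zero_less_one])
  have jac: "jacobian_det (\<lambda>q. Y q 1) (\<lambda>q. Y q 2) \<xi> > 0" for \<xi>
    unfolding jacobian_det_def Y1 Y2 pd_proj
      pd2_shear[OF C1_on_UNIV_I(1)[OF has_partials_proj(2)], OF continuous_on_const continuous_on_const]
    using be by simp
  have "p = shear al be (fst p, (snd p - al * fst p) / be)" for p
    using be by (simp add: shear_def)
  then have surj: "range (shear al be) = UNIV" by (rule surjI[OF sym])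
  have "inj Y"
    using be by (auto simp: inj_def Y_def graph_param_inj shear_def)
  moreover have rY: "range Y = graph_surface n f"
  proof -
    have "range Y = ?X ` range (shear al be)" unfolding Y_def by (rule image_image[symmetric])
    then show ?thesis by (simp add: graph_surface_def surj)
  qed
  ultimately have "conformal_param n f UNIV Y"
    unfolding conformal_param_def
    using conf E jac harmonic_shear(1)[OF lam, folded Y_def] by auto
  then show thesis using rY by (rule that)
qed

text \<open>The first coordinate function is x, so the first entry is 1.\<close>

lemma isotropic_vector_hom_coords: "isotropic_vector p \<in> hom_coords (n + 1)"
proof -
  have "isotropic_vector p 1 = 1"
    unfolding isotropic_vector_def phi_def graph_param_coords pd_proj by simp
  then have "isotropic_vector p 1 \<noteq> 0" by simp
  then show ?thesis by (auto simp: hom_coords_def isotropic_vector_def)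
qed

end

section \<open>Passage to projective space\<close>

lemma proj_point_scale:
  assumes "z \<in> hom_coords d" and "c \<noteq> 0"
  shows "proj_point d (\<lambda>k. c * z k) = proj_point d z"
proof -
  have "(\<lambda>k. c * z k) \<in> hom_coords d" using assms by (auto simp: hom_coords_def)
  moreover have "(\<exists>a. a \<noteq> 0 \<and> (\<forall>k. w k = a * (c * z k))) \<longleftrightarrow> (\<exists>a. a \<noteq> 0 \<and> (\<forall>k. w k = a * z k))" for w
  proof
    assume "\<exists>a. a \<noteq> 0 \<and> (\<forall>k. w k = a * (c * z k))"
    then obtain a where "a \<noteq> 0" "\<forall>k. w k = a * (c * z k)" by blast
    then show "\<exists>a. a \<noteq> 0 \<and> (\<forall>k. w k = a * z k)" using assms(2) by (intro exI[of _ "a * c"]) simp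
  next
    assume "\<exists>a. a \<noteq> 0 \<and> (\<forall>k. w k = a * z k)"
    then obtain a where "a \<noteq> 0" "\<forall>k. w k = a * z k" by blast
    then show "\<exists>a. a \<noteq> 0 \<and> (\<forall>k. w k = a * (c * z k))" using assms(2) by (intro exI[of _ "a / c"]) simp
  qed
  ultimately show ?thesis using assms(1) by (simp add: proj_point_def proportional_def)
qed

context minimal_graph_surface
begin

text \<open>Existence comes from \<open>ex_conformal_param\<close>, uniqueness from
  \<open>gauss_vector_eq\<close> and scaling invariance of projective points.\<close>

lemma gauss_map_eq: "gauss_map n f (graph_param n f p) = proj_point (n + 1) (isotropic_vector p)"
  unfolding gauss_map_def
proof (rule the_equality)
  have *: "proj_point (n + 1) (gauss_vector n Y \<xi>) = proj_point (n + 1) (isotropic_vector p)"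
    if Y: "conformal_param n f U Y" "\<xi> \<in> U" "Y \<xi> = graph_param n f p" for U Y \<xi>
  proof -
    obtain c where c: "c \<noteq> 0" "gauss_vector n Y \<xi> = (\<lambda>k. c * isotropic_vector p k)"
      using gauss_vector_eq[OF Y] by blast
    show ?thesis unfolding c(2) by (rule proj_point_scale[OF isotropic_vector_hom_coords c(1)])
  qed
  obtain Y where Y: "conformal_param n f UNIV Y" "range Y = graph_surface n f"
    by (rule ex_conformal_param)
  have "graph_param n f p \<in> range Y" unfolding Y(2) graph_surface_def by blast
  then obtain \<xi> where "Y \<xi> = graph_param n f p" by force
  with Y(1) * show "\<exists>U X \<xi>. conformal_param n f U X \<and> \<xi> \<in> U \<and> X \<xi> = graph_param n f p \<and>
      proj_point (n + 1) (isotropic_vector p) = proj_point (n + 1) (gauss_vector n X \<xi>)"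
    by (metis UNIV_I)
  show "L = proj_point (n + 1) (isotropic_vector p)"
    if "\<exists>U X \<xi>. conformal_param n f U X \<and> \<xi> \<in> U \<and> X \<xi> = graph_param n f p \<and>
      L = proj_point (n + 1) (gauss_vector n X \<xi>)" for L
    using that * by blast
qed

text \<open>The relation is homogeneous, so it passes from \<open>isotropic_vector\<close> to every
  representative of the class.\<close>

lemma gauss_map_in_hyperplane:
  assumes "i \<in> {1..n+2}" "j \<in> {1..n+2}" and "\<And>p. phi i p = mu * phi j p"
  shows "gauss_map n f ` graph_surface n f \<subseteq> coord_hyperplane (n + 1) i j mu"
proof -
  have "proj_point (n + 1) (isotropic_vector p) \<in> coord_hyperplane (n + 1) i j mu" for p
  proof -
    have "proj_point (n + 1) (isotropic_vector p) \<in> CP (n + 1)"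
      using isotropic_vector_hom_coords[of p] unfolding CP_def proj_point_def by (rule quotientI)
    moreover have "z i = mu * z j" if "z \<in> proj_point (n + 1) (isotropic_vector p)" for z
    proof -
      obtain c where "\<And>k. z k = c * isotropic_vector p k"
        using \<open>z \<in> _\<close> by (auto simp: proj_point_def proportional_def)
      then show ?thesis using assms by (simp add: isotropic_vector_def)
    qed
    ultimately show ?thesis by (simp add: coord_hyperplane_def)
  qed
  then show ?thesis by (auto simp: graph_surface_def gauss_map_eq[unfolded add_2_eq_Suc'])
qed

end

theorem lemma5:
  fixes n i j :: nat and f :: "nat \<Rightarrow> real \<times> real \<Rightarrow> real"
  assumes "n \<ge> 1"
    and "minimal_graph n f"
    and "1 \<le> i" and "i < j" and "j \<le> n + 2"
    and "(\<forall>p. jacobian_det (\<lambda>q. graph_param n f q i) (\<lambda>q. graph_param n f q j) p > 0) \<or>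
         (\<forall>p. jacobian_det (\<lambda>q. graph_param n f q i) (\<lambda>q. graph_param n f q j) p < 0)"
  shows "\<exists>mu::complex. mu \<notin> \<real> \<and>
           gauss_map n f ` graph_surface n f \<subseteq> coord_hyperplane (n + 1) i j mu \<and>
           (\<exists>l::complex. l \<notin> \<real> \<and>
             (\<forall>p. complex_of_real (pd1 (\<lambda>q. graph_param n f q i) p)
                    + l * complex_of_real (pd2 (\<lambda>q. graph_param n f q i) p)
                  = mu * (complex_of_real (pd1 (\<lambda>q. graph_param n f q j) p)
                    + l * complex_of_real (pd2 (\<lambda>q. graph_param n f q j) p))))"
proof -
  interpret minimal_graph_surface n f by (rule minimal_graph_surface.intro) fact
  have ij: "i \<in> {1..n+2}" "j \<in> {1..n+2}" using assms by auto
  obtain mu where mu: "mu \<notin> \<real>" "\<And>p. phi i p = mu * phi j p"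
    using phi_ratio_constant[OF ij assms(6)] by blast
  \<comment> \<open>The constant of part (b) is the value of \<open>lam\<close>. With it,
    \<open>phi i p = mu * phi j p\<close> is literally the identity claimed there, so the same
    \<open>mu\<close> serves both parts.\<close>
  obtain l where l: "\<And>p. lam p = l" using lam_constant by blast
  have "l \<notin> \<real>" using lam_Im[of "(0, 0)"] unfolding l complex_is_Real_iff by simp
  with mu gauss_map_in_hyperplane[OF ij mu(2)] show ?thesis
    unfolding phi_def l by blast
qed

end
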